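(* Let $n,r \in \mathbb{N}$, let $\chi$ be an $r$-colouring of $E(K_n)$, and let $X,Y_1,\ldots,Y_r \subset V(K_n)$. For every $p > 0$ and $\mu \ge 2^{10} r^3$, and every $t,m \in \mathbb{N}$ with $t \ge \mu^5 / p$, the following holds. If $$|N_i(x) \cap Y_i| \ge p|Y_i|$$ for every $x \in X$ and $i \in [r]$, and moreover $$|X| \ge \bigg( \frac{\mu^2}{p} \bigg)^{\mu r t} \qquad \text{and} \qquad |Y_i| \ge \bigg( \frac{e^{2^{13} r^3 / \mu^2}}{p} \bigg)^t \, m \quad\text{for every } i\in[r],$$ then $\chi$ contains a monochromatic $(t,m)$-book.
   Context: An $r$-colouring of $E(K_n)$ is a map $\chi$ from the edge set of the complete graph $K_n$ to $[r]=\{1,\dots,r\}$. For a vertex $u$ and colour $i$, $N_i(u)$ denotes the set of vertices $v \ne u$ with $\chi(uv)=i$ (the neighbourhood of $u$ in colour $i$). A $(t,m)$-book is a pair of disjoint vertex sets $(A,B)$ with $|A|=t$, $|B|=m$, together with the graph on $A\cup B$ whose edges are all pairs $uv$ with $\{u,v\}\not\subset B$; it is monochromatic (in colour $i$) if all of these edges have colour $i$ under $\chi$. *)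

theory Defs
  imports Complex_Main "HOL-Library.Ramsey"
begin

text \<open>
  The vertex set of \<open>K\<^sub>n\<close> is \<open>{1..n}\<close>; edges are two-element vertex sets, so that
  \<open>E(K\<^sub>n)\<close> is \<open>[{1..n}]\<^bsup>2\<^esup>\<close> in the notation of \<open>nsets\<close>.
\<close>

definition Kn_verts :: "nat \<Rightarrow> nat set" where
  "Kn_verts n = {1..n}"

definition Kn_edges :: "nat \<Rightarrow> nat set set" where
  "Kn_edges n = nsets (Kn_verts n) 2"

definition edge_colouring :: "nat \<Rightarrow> nat \<Rightarrow> (nat set \<Rightarrow> nat) \<Rightarrow> bool" where
  "edge_colouring n r \<chi> \<longleftrightarrow> \<chi> \<in> Kn_edges n \<rightarrow> {1..r}"

definition col_nbhd :: "nat \<Rightarrow> (nat set \<Rightarrow> nat) \<Rightarrow> nat \<Rightarrow> nat \<Rightarrow> nat set" where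
  "col_nbhd n \<chi> i u = {v \<in> Kn_verts n. v \<noteq> u \<and> \<chi> {u, v} = i}"

definition is_book :: "nat \<Rightarrow> nat \<Rightarrow> nat set \<Rightarrow> nat set \<Rightarrow> bool" where
  "is_book t m A B \<longleftrightarrow>
     finite A \<and> finite B \<and> A \<inter> B = {} \<and> card A = t \<and> card B = m"

definition book_edges :: "nat set \<Rightarrow> nat set \<Rightarrow> nat set set" where
  "book_edges A B = {e \<in> nsets (A \<union> B) 2. \<not> e \<subseteq> B}"

definition contains_mono_book :: "nat \<Rightarrow> nat \<Rightarrow> (nat set \<Rightarrow> nat) \<Rightarrow> nat \<Rightarrow> nat \<Rightarrow> bool" where
  "contains_mono_book n r \<chi> t m \<longleftrightarrow>
     (\<exists>i\<in>{1..r}. \<exists>A B. A \<subseteq> Kn_verts n \<and> B \<subseteq> Kn_verts n \<and> is_book t m A B \<and>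
        (\<forall>e\<in>book_edges A B. \<chi> e = i))"

end

theory Submission
  imports Defs
begin

text \<open>
  Collect spine vertices greedily. For a vertex \<open>x\<close> of \<open>X\<close> view \<open>N\<^sub>i(x) \<inter> Y\<^sub>i\<close>, recentred and rescaled, as a
  vector. If \<open>Z\<^sub>1, \<dots>, Z\<^sub>r\<close> are the inner products of these vectors for a random pair, then every
  mixed moment of the \<open>Z\<^sub>i\<close> is nonnegative, so \<open>f(Z)\<close> has nonnegative mean for each power series \<open>f\<close> with
  nonnegative coefficients. For \<open>f(z) = \<Sum>\<^sub>j z\<^sub>j \<Prod>\<^sub>i\<^sub>\<noteq>\<^sub>j (2 + cosh \<surd>z\<^sub>i)\<close> this gives a vertex \<open>x\<close>, a colour \<open>l\<close>,
  some \<open>\<lambda> \<ge> -1\<close> and a large subset \<open>X'\<close> of \<open>X\<close> such that, on passing to \<open>X'\<close> and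
  \<open>N\<^sub>i(x) \<inter> Y\<^sub>i\<close>, the excess of the density over a fixed threshold slightly below \<open>p\<close> shrinks by at most
  the factor \<open>1 - 1 / t\<close> in each colour, and is multiplied by at least \<open>1 + \<lambda> / t\<close> in colour \<open>l\<close>.

  If \<open>\<lambda>\<close> is small, add \<open>x\<close> to the spine of its most popular colour in \<open>X'\<close> and restrict only the
  reservoir of that colour; if \<open>\<lambda>\<close> is large, restrict \<open>Y\<^sub>l\<close> only. Densities are at most 1, so there is
  little room for boosts, and both \<open>X\<close> and the \<open>Y\<^sub>i\<close> survive until some spine has \<open>t\<close> vertices.
\<close>

section \<open>Schur multipliers\<close>

definition psd_on :: "'a set \<Rightarrow> ('a \<Rightarrow> 'a \<Rightarrow> real) \<Rightarrow> bool" where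
  "psd_on X K \<longleftrightarrow> (\<forall>f. 0 \<le> (\<Sum>x\<in>X. \<Sum>y\<in>X. f x * f y * K x y))"

text \<open>Stated through the action on all positive semidefinite kernels, so that closure under
  products is mere composition.\<close>

definition schur_multiplier :: "'a set \<Rightarrow> ('a \<Rightarrow> 'a \<Rightarrow> real) \<Rightarrow> bool" where
  "schur_multiplier X F \<longleftrightarrow> (\<forall>K. psd_on X K \<longrightarrow> psd_on X (\<lambda>x y. K x y * F x y))"

lemma psd_on_const: "0 \<le> c \<Longrightarrow> psd_on X (\<lambda>x y. c)"
proof -
  assume c: "0 \<le> c"
  have "(\<Sum>x\<in>X. \<Sum>y\<in>X. f x * f y * c) = c * (\<Sum>x\<in>X. f x)\<^sup>2" for f :: "'a \<Rightarrow> real"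
    by (simp add: power2_eq_square sum_product sum_distrib_left mult_ac)
  then show ?thesis using c by (simp add: psd_on_def)
qed

lemma psd_on_add: "psd_on X K \<Longrightarrow> psd_on X L \<Longrightarrow> psd_on X (\<lambda>x y. K x y + L x y)"
  by (simp add: psd_on_def distrib_left sum.distrib)

lemma psd_on_cmult:
  assumes "0 \<le> c" "psd_on X K" shows "psd_on X (\<lambda>x y. c * K x y)"
proof -
  have "(\<Sum>x\<in>X. \<Sum>y\<in>X. f x * f y * (c * K x y)) = c * (\<Sum>x\<in>X. \<Sum>y\<in>X. f x * f y * K x y)" for f
    by (simp add: sum_distrib_left mult_ac)
  then show ?thesis using assms by (simp add: psd_on_def)
qed

lemma psd_on_limit:
  assumes "\<And>n. psd_on X (K n)" "\<And>x y. x \<in> X \<Longrightarrow> y \<in> X \<Longrightarrow> (\<lambda>n. K n x y) \<longlonglongrightarrow> L x y"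
  shows "psd_on X L"
  unfolding psd_on_def
proof
  fix f
  have "(\<lambda>n. \<Sum>x\<in>X. \<Sum>y\<in>X. f x * f y * K n x y) \<longlonglongrightarrow> (\<Sum>x\<in>X. \<Sum>y\<in>X. f x * f y * L x y)"
    by (intro tendsto_sum tendsto_mult tendsto_const assms(2))
  moreover have "0 \<le> (\<Sum>x\<in>X. \<Sum>y\<in>X. f x * f y * K n x y)" for n
    using assms(1) by (simp add: psd_on_def)
  ultimately show "0 \<le> (\<Sum>x\<in>X. \<Sum>y\<in>X. f x * f y * L x y)"
    by (intro LIMSEQ_le_const) auto
qed

section \<open>Closure properties of Schur multipliers\<close>

lemma schur_multiplierD: "schur_multiplier X F \<Longrightarrow> psd_on X K \<Longrightarrow> psd_on X (\<lambda>x y. K x y * F x y)"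
  by (simp add: schur_multiplier_def)

lemma schur_multiplier_imp_psd: "schur_multiplier X F \<Longrightarrow> psd_on X F"
  using schur_multiplierD[OF _ psd_on_const[of 1]] by fastforce

lemma schur_multiplier_const: "0 \<le> c \<Longrightarrow> schur_multiplier X (\<lambda>x y. c)"
  using psd_on_cmult[of c X] by (simp add: schur_multiplier_def mult.commute)

lemma schur_multiplier_add:
  "schur_multiplier X F \<Longrightarrow> schur_multiplier X G \<Longrightarrow> schur_multiplier X (\<lambda>x y. F x y + G x y)"
  by (simp add: schur_multiplier_def distrib_left psd_on_add)

lemma schur_multiplier_mult:
  "schur_multiplier X F \<Longrightarrow> schur_multiplier X G \<Longrightarrow> schur_multiplier X (\<lambda>x y. F x y * G x y)"
  by (simp add: schur_multiplier_def flip: mult.assoc)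

lemma schur_multiplier_sum:
  "(\<And>i. i \<in> I \<Longrightarrow> schur_multiplier X (F i)) \<Longrightarrow> schur_multiplier X (\<lambda>x y. \<Sum>i\<in>I. F i x y)"
  by (induction I rule: infinite_finite_induct)
    (auto intro: schur_multiplier_const[of 0, simplified] schur_multiplier_add)

lemma schur_multiplier_prod:
  "(\<And>i. i \<in> I \<Longrightarrow> schur_multiplier X (F i)) \<Longrightarrow> schur_multiplier X (\<lambda>x y. \<Prod>i\<in>I. F i x y)"
  by (induction I rule: infinite_finite_induct)
    (auto intro: schur_multiplier_const[of 1, simplified] schur_multiplier_mult)

lemma schur_multiplier_power:
  "schur_multiplier X F \<Longrightarrow> schur_multiplier X (\<lambda>x y. F x y ^ n)"
  using schur_multiplier_prod[of "{..<n}" X "\<lambda>_. F"] by simp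

text \<open>Carries closure from polynomials with nonnegative coefficients over to convergent power
  series.\<close>

lemma schur_multiplier_limit:
  assumes "\<And>n. schur_multiplier X (F n)"
    and "\<And>x y. x \<in> X \<Longrightarrow> y \<in> X \<Longrightarrow> (\<lambda>n. F n x y) \<longlonglongrightarrow> G x y"
  shows "schur_multiplier X G"
  unfolding schur_multiplier_def
proof (intro allI impI)
  fix K assume "psd_on X K"
  with assms(1) have "psd_on X (\<lambda>x y. K x y * F n x y)" for n
    by (rule schur_multiplierD)
  then show "psd_on X (\<lambda>x y. K x y * G x y)"
  proof (rule psd_on_limit)
    show "(\<lambda>n. K x y * F n x y) \<longlonglongrightarrow> K x y * G x y" if "x \<in> X" "y \<in> X" for x y
      by (intro tendsto_mult tendsto_const assms(2) that)
  qed
qed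

text \<open>A rank one factor \<open>s v x * s v y\<close> is absorbed into the quadratic form by
  replacing the test function \<open>f\<close> with \<open>f * s v\<close>; a Gram kernel is a sum
  of such factors.\<close>

lemma schur_multiplier_gram: "schur_multiplier X (\<lambda>x y. \<Sum>v\<in>V. s v x * s v y)"
proof (intro schur_multiplier_sum)
  fix v
  have "(\<Sum>x\<in>X. \<Sum>y\<in>X. f x * f y * (K x y * (s v x * s v y)))
      = (\<Sum>x\<in>X. \<Sum>y\<in>X. (f x * s v x) * (f y * s v y) * K x y)" for f K
    by (simp add: mult_ac)
  then show "schur_multiplier X (\<lambda>x y. s v x * s v y)"
    by (simp add: schur_multiplier_def psd_on_def)
qed

section \<open>The moment function\<close>

text \<open>The entire function with Taylor coefficients \<open>1 / fact (2 * n)\<close>. The case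
  split matters because the real \<open>sqrt\<close> is odd: \<open>cosh (sqrt x)\<close> would be
  large for very negative \<open>x\<close>, while this function stays between -1 and 1
  there.\<close>

definition cosh_sqrt :: "real \<Rightarrow> real" where
  "cosh_sqrt x = (if 0 \<le> x then cosh (sqrt x) else cos (sqrt (- x)))"

lemma cosh_sqrt_sums: "(\<lambda>n. x ^ n / fact (2 * n)) sums cosh_sqrt x"
proof (cases "0 \<le> x")
  case True
  let ?f = "\<lambda>n. if even n then sqrt x ^ n /\<^sub>R fact n else 0"
  have "(\<lambda>n. ?f (2 * n)) sums cosh (sqrt x)"
  proof (subst sums_mono_reindex)
    show "strict_mono (\<lambda>n::nat. 2 * n)" by (simp add: strict_mono_def)
    show "?f n = 0" if "n \<notin> range (\<lambda>n. 2 * n)" for n using that by (auto elim!: evenE)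
    show "?f sums cosh (sqrt x)" by (rule cosh_converges)
  qed
  moreover have "?f (2 * n) = x ^ n / fact (2 * n)" for n
    using True power_mult[of "sqrt x" 2 n] by (simp add: divide_inverse)
  ultimately show ?thesis using True by (simp add: cosh_sqrt_def)
next
  case False
  have "(- 1) ^ n / fact (2 * n) * sqrt (- x) ^ (2 * n) = x ^ n / fact (2 * n)" for n
    using False by (simp add: power_mult flip: power_mult_distrib)
  with cos_paired[of "sqrt (- x)"] False show ?thesis by (simp add: cosh_sqrt_def)
qed

lemma schur_multiplier_cosh_sqrt:
  assumes "schur_multiplier X F"
  shows "schur_multiplier X (\<lambda>x y. cosh_sqrt (F x y))"
proof (rule schur_multiplier_limit)
  show "schur_multiplier X (\<lambda>x y. \<Sum>k<n. F x y ^ k * (1 / fact (2 * k)))" for n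
    by (intro schur_multiplier_sum schur_multiplier_mult schur_multiplier_power
        schur_multiplier_const assms) simp
  show "(\<lambda>n. \<Sum>k<n. F x y ^ k * (1 / fact (2 * k))) \<longlonglongrightarrow> cosh_sqrt (F x y)" for x y
    using cosh_sqrt_sums by (simp add: sums_def)
qed

lemma cosh_sqrt_ge_minus_1: "- 1 \<le> cosh_sqrt x"
  using cosh_real_ge_1[of "sqrt x"] by (simp add: cosh_sqrt_def)

lemma cosh_sqrt_le_1: "x \<le> 0 \<Longrightarrow> cosh_sqrt x \<le> 1"
  by (cases "x = 0") (auto simp: cosh_sqrt_def)

lemma cosh_le_exp: "0 \<le> x \<Longrightarrow> cosh x \<le> exp x" for x :: real
proof -
  assume "0 \<le> x"
  then have "exp (- x) \<le> exp x" by simp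
  then show ?thesis by (simp add: cosh_def)
qed

lemma cosh_sqrt_le_exp:
  assumes "x \<le> y" "0 \<le> y"
  shows "cosh_sqrt x \<le> exp (sqrt y)"
proof (cases "0 \<le> x")
  case True
  then have "cosh_sqrt x \<le> exp (sqrt x)" by (simp add: cosh_sqrt_def cosh_le_exp)
  also have "\<dots> \<le> exp (sqrt y)" using assms by simp
  finally show ?thesis .
next
  case False
  then have "cosh_sqrt x \<le> 1" by (simp add: cosh_sqrt_le_1)
  also have "\<dots> \<le> exp (sqrt y)" using assms by simp
  finally show ?thesis .
qed

lemma le_cosh_sqrt: "x \<le> 2 + cosh_sqrt x"
proof (cases "0 \<le> x")
  case True
  have "(\<Sum>n<3. x ^ n / fact (2 * n)) \<le> (\<Sum>n. x ^ n / fact (2 * n))"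
    using cosh_sqrt_sums[of x] True by (intro sum_le_suminf) (auto simp: sums_iff)
  also have "\<dots> = cosh_sqrt x" using cosh_sqrt_sums[of x] by (simp add: sums_iff)
  finally have "1 + x / 2 + x\<^sup>2 / 24 \<le> cosh_sqrt x"
    by (simp add: eval_nat_numeral fact_numeral)
  \<comment> \<open>\<open>3 + x / 2 + x\<^sup>2 / 24 - x\<close> equals
    \<open>(x - 6)\<^sup>2 / 24 + 3 / 2\<close>.\<close>
  moreover have "0 \<le> (x - 6)\<^sup>2" by simp
  ultimately show ?thesis by (simp add: power2_eq_square algebra_simps)
next
  case False
  then show ?thesis using cosh_sqrt_ge_minus_1[of x] by simp
qed

lemma divide_cosh_sqrt_le_1: "x / (2 + cosh_sqrt x) \<le> 1"
  using le_cosh_sqrt[of x] cosh_sqrt_ge_minus_1[of x] by (simp add: divide_le_eq)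

text \<open>All Taylor coefficients of this function are nonnegative, so its average over a family of Gram
  kernels is nonnegative; yet it is at most \<open>-1\<close> as soon as one argument is very negative.\<close>

definition moment_fun :: "'i set \<Rightarrow> ('i \<Rightarrow> real) \<Rightarrow> real" where
  "moment_fun I z = (\<Sum>j\<in>I. z j * (\<Prod>i\<in>I - {j}. 2 + cosh_sqrt (z i)))"

lemma schur_multiplier_moment_fun:
  assumes "\<And>i. i \<in> I \<Longrightarrow> schur_multiplier X (W i)"
  shows "schur_multiplier X (\<lambda>x y. moment_fun I (\<lambda>i. W i x y))"
  unfolding moment_fun_def
  by (intro schur_multiplier_sum schur_multiplier_mult schur_multiplier_prod schur_multiplier_add
      schur_multiplier_cosh_sqrt schur_multiplier_const) (auto intro: assms)

text \<open>Dividing by \<open>2 + cosh_sqrt (z j)\<close>, which is at least 1, turns each product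
  without \<open>j\<close> into the full product and leaves ratios that never exceed 1.\<close>

lemma moment_fun_eq:
  assumes "finite I"
  shows "moment_fun I z
    = (\<Sum>j\<in>I. z j / (2 + cosh_sqrt (z j))) * (\<Prod>i\<in>I. 2 + cosh_sqrt (z i))"
proof -
  have "(\<Prod>i\<in>I. 2 + cosh_sqrt (z i)) = (2 + cosh_sqrt (z j)) * (\<Prod>i\<in>I - {j}. 2 + cosh_sqrt (z i))"
    if "j \<in> I" for j using assms that by (rule prod.remove)
  moreover have "2 + cosh_sqrt (z j) \<noteq> 0" for j using cosh_sqrt_ge_minus_1[of "z j"] by linarith
  ultimately show ?thesis by (simp add: moment_fun_def sum_distrib_right)
qed

text \<open>The ratios sum to at most \<open>card I\<close>, and each factor of the product is at
  most \<open>3 * exp (sqrt (z i + B))\<close>; the shift by \<open>B\<close> makes one formula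
  serve both signs of \<open>z i\<close>.\<close>

lemma moment_fun_le:
  assumes "finite I" "0 \<le> B" "\<And>i. i \<in> I \<Longrightarrow> - B \<le> z i"
  shows "moment_fun I z \<le> real (card I) * 3 ^ card I * exp (\<Sum>i\<in>I. sqrt (z i + B))"
proof -
  have pos: "1 \<le> 2 + cosh_sqrt x" for x using cosh_sqrt_ge_minus_1[of x] by simp
  have "(\<Sum>j\<in>I. z j / (2 + cosh_sqrt (z j))) \<le> (\<Sum>j\<in>I. 1)"
    by (intro sum_mono divide_cosh_sqrt_le_1)
  then have "moment_fun I z \<le> card I * (\<Prod>i\<in>I. 2 + cosh_sqrt (z i))"
    unfolding moment_fun_eq[OF assms(1)] using pos
    by (intro mult_right_mono prod_nonneg) (auto intro: order_trans[OF zero_le_one])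
  also have "(\<Prod>i\<in>I. 2 + cosh_sqrt (z i)) \<le> (\<Prod>i\<in>I. 3 * exp (sqrt (z i + B)))"
  proof (intro prod_mono conjI)
    fix i assume i: "i \<in> I"
    show "0 \<le> 2 + cosh_sqrt (z i)" using pos[of "z i"] by simp
    have "cosh_sqrt (z i) \<le> exp (sqrt (z i + B))"
      using assms(2) assms(3)[OF i] by (intro cosh_sqrt_le_exp) auto
    moreover have "1 \<le> exp (sqrt (z i + B))" using assms(3)[OF i] one_le_exp_iff by force
    ultimately show "2 + cosh_sqrt (z i) \<le> 3 * exp (sqrt (z i + B))" by linarith
  qed
  also have "\<dots> = 3 ^ card I * exp (\<Sum>i\<in>I. sqrt (z i + B))"
    using assms(1) by (simp add: prod.distrib exp_sum)
  finally show ?thesis by (simp add: mult_left_mono mult.assoc)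
qed

text \<open>For nonpositive \<open>z j\<close> the denominator is at most 3, so the ratio of
  \<open>j\<close> is at most \<open>- card I\<close>. The other \<open>card I - 1\<close> ratios
  are at most 1 each, so the sum is at most -1, and the product multiplying it is at least
  1.\<close>

lemma moment_fun_le_minus_1:
  assumes "finite I" "j \<in> I" "z j \<le> - 3 * real (card I)"
  shows "moment_fun I z \<le> - 1"
proof -
  have pos: "1 \<le> 2 + cosh_sqrt x" for x using cosh_sqrt_ge_minus_1[of x] by simp
  have "2 + cosh_sqrt (z j) \<le> 3" using assms(3) cosh_sqrt_le_1[of "z j"] by simp
  then have "real (card I) * (2 + cosh_sqrt (z j)) \<le> real (card I) * 3"
    by (intro mult_left_mono) auto
  then have "z j / (2 + cosh_sqrt (z j)) \<le> - real (card I)"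
    using pos[of "z j"] assms(3) by (simp add: divide_le_eq)
  moreover have "(\<Sum>i\<in>I - {j}. z i / (2 + cosh_sqrt (z i))) \<le> (\<Sum>i\<in>I - {j}. 1)"
    by (intro sum_mono divide_cosh_sqrt_le_1)
  moreover have "real (card (I - {j})) = real (card I) - 1"
    using card_Suc_Diff1[OF assms(1,2)] by linarith
  ultimately have "(\<Sum>i\<in>I. z i / (2 + cosh_sqrt (z i))) \<le> - 1"
    using assms by (simp add: sum.remove)
  moreover have "1 \<le> (\<Prod>i\<in>I. 2 + cosh_sqrt (z i))" by (intro prod_ge_1 pos)
  ultimately show ?thesis unfolding moment_fun_eq[OF assms(1)]
    using mult_mono[of 1 "- (\<Sum>i\<in>I. z i / (2 + cosh_sqrt (z i)))" 1 "\<Prod>i\<in>I. 2 + cosh_sqrt (z i)"]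
    by simp
qed

section \<open>Correlated pairs\<close>

text \<open>Below, a proportion of at least \<open>\<beta> exp (- C sqrt (\<lambda> + 1))\<close> of all pairs has correlation at least \<open>\<lambda>\<close>
  in some colour, with \<open>C = corr_cost r\<close> and \<open>\<beta> = corr_const r\<close>.\<close>

definition corr_cost :: "nat \<Rightarrow> real" where
  "corr_cost r = 4 * (real r * sqrt (real r))"

definition corr_const :: "nat \<Rightarrow> real" where
  "corr_const r = (1 / 3) ^ (4 * r)"

lemma corr_const_pos: "0 < corr_const k" "corr_const k \<le> 1"
  by (auto simp: corr_const_def power_le_one)

text \<open>The numerical gap behind the contradiction in \<open>exists_correlated_pairs\<close>:
  since \<open>real r ^ 2 \<le> 3 ^ r\<close>, the left side is at most \<open>5 / 9\<close>, while
  \<open>corr_const r \<le> 1 / 81\<close>.\<close>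

lemma corr_const_bound:
  assumes "1 \<le> r"
  shows "5 * real r ^ 2 * 3 ^ r * corr_const r < 1 - corr_const r"
proof -
  have "real r ^ 2 \<le> 3 ^ r"
  proof -
    have "r ^ 2 \<le> 3 ^ r"
    proof (induction r rule: less_induct)
      case (less n)
      show ?case
      proof (cases "n \<le> 2")
        case False
        then obtain m where m: "n = Suc m" "2 \<le> m" by (cases n) auto
        have "2 * m \<le> m * m" "1 \<le> m * m" using m by simp_all
        moreover have "Suc m ^ 2 = m * m + 2 * m + 1" "3 * m ^ 2 = 3 * (m * m)"
          by (simp_all add: power2_eq_square)
        ultimately have "Suc m ^ 2 \<le> 3 * m ^ 2" by linarith
        then show ?thesis using less[of m] m by simp
      qed (auto simp: le_Suc_eq numeral_2_eq_2)
    qed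
    then have "real (r ^ 2) \<le> real (3 ^ r)" by (rule of_nat_mono)
    then show ?thesis by simp
  qed
  then have "5 * real r ^ 2 * 3 ^ r * corr_const r \<le> 5 * 3 ^ r * 3 ^ r * corr_const r"
    by (intro mult_right_mono) (auto simp: corr_const_def)
  also have "\<dots> = 5 * (1 / 9) ^ r"
  proof -
    have "(3::real) ^ r * 3 ^ r * (1 / 3) ^ (4 * r) = (3 * 3 * (1 / 3) ^ 4) ^ r"
      by (simp only: power_mult power_mult_distrib)
    then show ?thesis by (simp add: corr_const_def eval_nat_numeral)
  qed
  also have "(1 / 9) ^ r \<le> (1 / 9 :: real)"
    using power_decreasing[of 1 r "1 / 9 :: real"] assms by simp
  finally have "5 * real r ^ 2 * 3 ^ r * corr_const r \<le> 5 / 9" by simp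
  moreover have "corr_const r \<le> 1 / 81"
    unfolding corr_const_def using power_decreasing[of 4 "4 * r" "1 / 3 :: real"] assms
    by (simp add: eval_nat_numeral)
  ultimately show ?thesis by linarith
qed

text \<open>Cut the values of \<open>S\<close> into unit layers. A point in layer \<open>j\<close>
  contributes at most \<open>exp (j + 1)\<close>, and the tail bound turns the sum over layers into
  a geometric series.\<close>

lemma sum_exp_le_of_tail_bound:
  fixes S :: "'b \<Rightarrow> real"
  assumes fin: "finite E" and nonneg: "\<And>e. e \<in> E \<Longrightarrow> 0 \<le> S e"
    and tail: "\<And>s. 0 \<le> s \<Longrightarrow> real (card {e \<in> E. s \<le> S e}) \<le> A * exp (- 2 * s)"
  shows "(\<Sum>e\<in>E. exp (S e)) \<le> 5 * A"
proof -
  have A: "0 \<le> A" using order_trans[OF _ tail[of 0]] by simp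
  define k where "k e = nat \<lfloor>S e\<rfloor>" for e
  obtain K where K: "\<And>e. e \<in> E \<Longrightarrow> k e < K"
    using finite_nat_bounded[of "k ` E"] fin by auto
  have "exp (S e) \<le> (\<Sum>j<K. if real j \<le> S e then exp (real j + 1) else 0)" if e: "e \<in> E" for e
  proof -
    have "exp (S e) \<le> exp (real (k e) + 1)" using nonneg[OF e] by (simp add: k_def)
    also have "\<dots> = (if real (k e) \<le> S e then exp (real (k e) + 1) else 0)"
      using nonneg[OF e] by (simp add: k_def)
    also have "\<dots> \<le> (\<Sum>j<K. if real j \<le> S e then exp (real j + 1) else 0)"
      using K[OF e] by (intro member_le_sum) auto
    finally show ?thesis .
  qed
  then have "(\<Sum>e\<in>E. exp (S e)) \<le> (\<Sum>e\<in>E. \<Sum>j<K. if real j \<le> S e then exp (real j + 1) else 0)"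
    by (rule sum_mono)
  also have "\<dots> = (\<Sum>j<K. \<Sum>e\<in>E. if real j \<le> S e then exp (real j + 1) else 0)"
    by (rule sum.swap)
  also have "\<dots> = (\<Sum>j<K. card {e \<in> E. real j \<le> S e} * exp (real j + 1))"
    using fin by (simp add: sum.If_cases Int_def)
  also have "\<dots> \<le> (\<Sum>j<K. A * exp (- 2 * real j) * exp (real j + 1))"
    by (intro sum_mono mult_right_mono tail) auto
  also have "\<dots> = A * exp 1 * (\<Sum>j<K. exp (- 1) ^ j)"
    by (simp add: sum_distrib_left mult.assoc flip: exp_add exp_of_nat_mult)
  also have "(\<Sum>j<K. exp (- 1) ^ j) \<le> (1 / (1 - exp (- 1)) :: real)"
    by (simp add: sum_gp_strict divide_right_mono)
  also have "A * exp 1 * (1 / (1 - exp (- 1))) \<le> 5 * A"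
  proof -
    have e: "exp 1 \<ge> (2 :: real)" using exp_ge_add_one_self[of 1] by simp
    have e3: "exp 1 \<le> (3 :: real)" using exp_le by simp
    have "exp 1 * (1 / (1 - exp (- 1))) = exp 1 * exp 1 / (exp 1 - 1 :: real)"
      using e by (simp add: exp_minus field_simps)
    also have "\<dots> \<le> 5"
    proof -
      \<comment> \<open>The quadratic with roots 2 and 3 gives \<open>e * e \<le> 5 * e - 6\<close>
        for \<open>e = exp 1\<close>, whence the constant 5.\<close>
      have "0 \<le> (exp 1 - 2) * (3 - exp 1 :: real)" using e e3 by (intro mult_nonneg_nonneg) auto
      then have "exp 1 * exp 1 \<le> 5 * (exp 1 - 1 :: real)" using e e3 by (simp add: algebra_simps)
      then show ?thesis using e by (simp add: divide_le_eq)
    qed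
    finally have "A * (exp 1 * (1 / (1 - exp (- 1)))) \<le> A * 5" using A by (rule mult_left_mono)
    then show ?thesis by (simp only: mult_ac)
  qed
  finally show ?thesis using A by (simp add: mult_left_mono)
qed

text \<open>Otherwise all tails are small, so \<open>exp S\<close> has a small sum over the set
  \<open>E\<close> of pairs with every correlation at least -1, and \<open>E\<close> itself is
  small. But each pair outside \<open>E\<close> contributes at most -1 to a sum of
  \<open>moment_fun\<close> values that is nonnegative by positivity of the kernel.\<close>

lemma exists_correlated_pairs:
  fixes W :: "'i \<Rightarrow> 'a \<Rightarrow> 'a \<Rightarrow> real"
  assumes X: "finite X" "X \<noteq> {}" and I: "finite I" "I \<noteq> {}"
    and W: "\<And>i. i \<in> I \<Longrightarrow> schur_multiplier X (W i)"
  obtains l lam where "l \<in> I" "- 1 \<le> lam"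
    "corr_const (card I) * exp (- corr_cost (card I) * sqrt (lam + 1)) * real (card X) ^ 2
      \<le> card {(x, y) \<in> X \<times> X. (\<forall>i\<in>I. - 1 \<le> W i x y) \<and> lam \<le> W l x y}"
proof (rule ccontr)
  assume neg: "\<not> thesis"
  note found = that
  define r where "r = card I"
  define N where "N = real (card X) ^ 2"
  define E where "E = {(x, y) \<in> X \<times> X. \<forall>i\<in>I. - 1 \<le> W i x y}"
  \<comment> \<open>There are \<open>r\<close> summands \<open>sqrt (3 * r) * sqrt (W + 1)\<close>,
    and 3 is rounded up to 4. As \<open>corr_cost r = 2 * c\<close>, the tails of \<open>S\<close>
    decay at rate 2, faster than \<open>exp S\<close> grows.\<close>
  define c where "c = 2 * (real r * sqrt (real r))"
  define S where "S = (\<lambda>(x, y). c * Max ((\<lambda>i. sqrt (W i x y + 1)) ` I))"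
  have r: "1 \<le> r" using I by (simp add: r_def Suc_le_eq card_gt_0_iff)
  have N: "0 < N" using X by (simp add: N_def card_gt_0_iff)
  have c: "0 < c" using r by (simp add: c_def)
  have E: "finite E" "E \<subseteq> X \<times> X"
    using X by (auto simp: E_def intro: finite_subset[of _ "X \<times> X"])
  have neg': "real (card {e \<in> E. lam \<le> W i (fst e) (snd e)})
      \<le> corr_const r * exp (- 2 * c * sqrt (lam + 1)) * N" if "i \<in> I" "- 1 \<le> lam" for i lam
  proof (rule ccontr)
    assume *: "\<not> ?thesis"
    have "{e \<in> E. lam \<le> W i (fst e) (snd e)}
        = {(x, y) \<in> X \<times> X. (\<forall>i\<in>I. - 1 \<le> W i x y) \<and> lam \<le> W i x y}"
      by (auto simp: E_def)
    with * have thesis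
      by (intro found[OF \<open>i \<in> I\<close> \<open>- 1 \<le> lam\<close>])
        (simp add: r_def[symmetric] N_def[symmetric] c_def corr_cost_def mult_ac)
    with neg show False by blast
  qed
  have nonneg: "0 \<le> 3 * real r * W i (fst e) (snd e) + 3 * real r" if "e \<in> E" "i \<in> I" for e i
  proof -
    have "0 \<le> 3 * real r * (W i (fst e) (snd e) + 1)"
      using that by (intro mult_nonneg_nonneg) (force simp: E_def)+
    then show ?thesis by (simp add: distrib_left)
  qed
  have sumS: "(\<Sum>i\<in>I. sqrt (3 * real r * W i (fst e) (snd e) + 3 * real r)) \<le> S e" if "e \<in> E" for e
  proof -
    let ?M = "Max ((\<lambda>i. sqrt (W i (fst e) (snd e) + 1)) ` I)"
    have "(\<Sum>i\<in>I. sqrt (3 * real r * W i (fst e) (snd e) + 3 * real r))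
        = (\<Sum>i\<in>I. sqrt (3 * real r) * sqrt (W i (fst e) (snd e) + 1))"
      by (simp add: algebra_simps flip: real_sqrt_mult)
    also have "\<dots> \<le> (\<Sum>i\<in>I. sqrt (4 * real r) * ?M)"
      using that I by (intro sum_mono mult_mono) (auto simp: E_def)
    also have "\<dots> = S e" by (simp add: S_def c_def r_def real_sqrt_mult case_prod_beta)
    finally show ?thesis .
  qed
  have "(\<Sum>e\<in>E. exp (S e)) \<le> 5 * (real r * corr_const r * N)"
  proof (rule sum_exp_le_of_tail_bound[OF E(1)])
    show "0 \<le> S e" if "e \<in> E" for e
      using nonneg[OF that] by (intro order_trans[OF sum_nonneg sumS[OF that]]) auto
    fix s :: real assume s: "0 \<le> s"
    \<comment> \<open>The maximum defining \<open>S\<close> is attained in some colour, so a union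
      bound over colours costs only a factor \<open>r\<close>.\<close>
    have "{e \<in> E. s \<le> S e} \<subseteq> (\<Union>i\<in>I. {e \<in> E. (s / c)\<^sup>2 - 1 \<le> W i (fst e) (snd e)})"
    proof
      fix e assume e: "e \<in> {e \<in> E. s \<le> S e}"
      let ?M = "Max ((\<lambda>i. sqrt (W i (fst e) (snd e) + 1)) ` I)"
      have "?M \<in> (\<lambda>i. sqrt (W i (fst e) (snd e) + 1)) ` I" using I by (intro Max_in) auto
      then obtain i where i: "i \<in> I" "?M = sqrt (W i (fst e) (snd e) + 1)" by auto
      have "s / c \<le> ?M" using e c by (simp add: S_def case_prod_beta field_simps)
      then have "(s / c)\<^sup>2 \<le> (sqrt (W i (fst e) (snd e) + 1))\<^sup>2"
        using s c i by (intro power_mono) auto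
      also have "\<dots> = W i (fst e) (snd e) + 1"
        using e i by (intro real_sqrt_pow2) (force simp: E_def)
      finally have "(s / c)\<^sup>2 - 1 \<le> W i (fst e) (snd e)" by linarith
      then show "e \<in> (\<Union>i\<in>I. {e \<in> E. (s / c)\<^sup>2 - 1 \<le> W i (fst e) (snd e)})"
        using e i by blast
    qed
    then have "card {e \<in> E. s \<le> S e} \<le> card (\<Union>i\<in>I. {e \<in> E. (s / c)\<^sup>2 - 1 \<le> W i (fst e) (snd e)})"
      using E I by (intro card_mono) auto
    also have "\<dots> \<le> (\<Sum>i\<in>I. card {e \<in> E. (s / c)\<^sup>2 - 1 \<le> W i (fst e) (snd e)})"
      using I by (intro card_UN_le)
    finally have "real (card {e \<in> E. s \<le> S e})
        \<le> (\<Sum>i\<in>I. real (card {e \<in> E. (s / c)\<^sup>2 - 1 \<le> W i (fst e) (snd e)}))"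
      by (simp flip: of_nat_sum)
    also have "\<dots> \<le> (\<Sum>i\<in>I. corr_const r * exp (- 2 * c * sqrt ((s / c)\<^sup>2 - 1 + 1)) * N)"
      by (intro sum_mono neg') auto
    also have "\<dots> = real r * corr_const r * N * exp (- 2 * s)"
      using s c by (simp add: r_def)
    finally show "real (card {e \<in> E. s \<le> S e}) \<le> real r * corr_const r * N * exp (- 2 * s)" .
  qed
  moreover have "real (card E) \<le> corr_const r * N"
  proof -
    obtain i where i: "i \<in> I" using I by auto
    \<comment> \<open>At the threshold -1 the tail of any single colour is all of
      \<open>E\<close>.\<close>
    have "{e \<in> E. - 1 \<le> W i (fst e) (snd e)} = E" using i by (auto simp: E_def)
    then show ?thesis using neg'[OF i, of "- 1"] by simp
  qed
  moreover have "0 \<le> real r * 3 ^ r * (\<Sum>e\<in>E. exp (S e)) - (N - card E)"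
  proof -
    \<comment> \<open>The scaling by \<open>3 * r\<close> moves a correlation below -1 into the
      range of \<open>moment_fun_le_minus_1\<close>.\<close>
    define F where "F e = moment_fun I (\<lambda>i. 3 * real r * W i (fst e) (snd e))" for e
    have "schur_multiplier X (\<lambda>x y. moment_fun I (\<lambda>i. 3 * real r * W i x y))"
      by (intro schur_multiplier_moment_fun schur_multiplier_mult W schur_multiplier_const) auto
    then have "0 \<le> (\<Sum>x\<in>X. \<Sum>y\<in>X. 1 * 1 * moment_fun I (\<lambda>i. 3 * real r * W i x y))"
      unfolding psd_on_def by (drule_tac schur_multiplier_imp_psd) (auto simp: psd_on_def dest: spec[of _ "\<lambda>_. 1"])
    also have "\<dots> = (\<Sum>e\<in>X \<times> X. F e)"
      by (simp add: F_def sum.cartesian_product case_prod_beta)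
    also have "\<dots> = (\<Sum>e\<in>E. F e) + (\<Sum>e\<in>X \<times> X - E. F e)"
      using E X by (simp add: sum.subset_diff[of E "X \<times> X"])
    also have "(\<Sum>e\<in>E. F e) \<le> (\<Sum>e\<in>E. real r * 3 ^ r * exp (S e))"
    proof (intro sum_mono)
      fix e assume e: "e \<in> E"
      have "F e \<le> real r * 3 ^ r
          * exp (\<Sum>i\<in>I. sqrt (3 * real r * W i (fst e) (snd e) + 3 * real r))"
        unfolding F_def r_def
      proof (rule moment_fun_le)
        show "- (3 * real (card I)) \<le> 3 * real (card I) * W i (fst e) (snd e)" if "i \<in> I" for i
          using nonneg[OF e that] by (simp add: r_def)
      qed (use I in auto)
      also have "\<dots> \<le> real r * 3 ^ r * exp (S e)"
        using sumS[OF e] by (intro mult_left_mono) auto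
      finally show "F e \<le> real r * 3 ^ r * exp (S e)" .
    qed
    also have "(\<Sum>e\<in>X \<times> X - E. F e) \<le> (\<Sum>e\<in>X \<times> X - E. - 1)"
    proof (intro sum_mono)
      fix e assume "e \<in> X \<times> X - E"
      then have "\<exists>i\<in>I. \<not> - 1 \<le> W i (fst e) (snd e)" by (auto simp: E_def)
      then obtain i where i: "i \<in> I" "W i (fst e) (snd e) < - 1" by (auto simp: not_le)
      then have "3 * real r * W i (fst e) (snd e) \<le> 3 * real r * (- 1)"
        by (intro mult_left_mono) auto
      then show "F e \<le> - 1" unfolding F_def
        using i I by (intro moment_fun_le_minus_1[of _ i]) (auto simp: r_def)
    qed
    also have "(\<Sum>e\<in>X \<times> X - E. - 1) = - (N - real (card E))"
    proof -
      have "card E \<le> card (X \<times> X)" using E X by (intro card_mono) auto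
      then show ?thesis using E
        by (simp add: card_Diff_subset of_nat_diff N_def card_cartesian_product power2_eq_square)
    qed
    finally show ?thesis by (simp add: sum_distrib_left)
  qed
  ultimately have "N \<le> real r * 3 ^ r * (5 * (real r * corr_const r * N)) + corr_const r * N"
    using mult_left_mono[of "\<Sum>e\<in>E. exp (S e)" "5 * (real r * corr_const r * N)" "real r * 3 ^ r"]
    by simp
  then have "N * 1 \<le> N * (5 * real r ^ 2 * 3 ^ r * corr_const r + corr_const r)"
    by (simp add: power2_eq_square algebra_simps)
  then show False using corr_const_bound[OF r] N by (subst (asm) mult_le_cancel_left_pos) auto
qed

text \<open>Centred indicator vectors of neighbourhoods in \<open>Y i\<close> have a Gram kernel, so
  correlated pairs exist. A correlation \<open>s\<close> of \<open>x\<close> and \<open>y\<close>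
  says that the neighbourhood of \<open>y\<close> has density at least
  \<open>a i / card (Y i) + s * \<alpha> i\<close> inside that of \<open>x\<close>.\<close>

lemma exists_dense_step:
  fixes N :: "'i \<Rightarrow> 'a \<Rightarrow> 'b set" and Y :: "'i \<Rightarrow> 'b set" and \<alpha> :: "'i \<Rightarrow> real" and a :: "'i \<Rightarrow> nat"
  assumes X: "finite X" "X \<noteq> {}" and I: "finite I" "I \<noteq> {}"
    and Y: "\<And>i. i \<in> I \<Longrightarrow> finite (Y i)"
    and pos: "\<And>i. i \<in> I \<Longrightarrow> 0 < \<alpha> i" "\<And>i. i \<in> I \<Longrightarrow> 0 < a i"
    and a: "\<And>i x. i \<in> I \<Longrightarrow> x \<in> X \<Longrightarrow> a i \<le> card (N i x \<inter> Y i)"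
  obtains x l s X' Y' where
    "x \<in> X" "l \<in> I" "- 1 \<le> s" "X' \<subseteq> X"
    "corr_const (card I) * exp (- corr_cost (card I) * sqrt (s + 1)) * real (card X) \<le> card X'"
    "\<forall>i\<in>I. Y' i \<subseteq> N i x \<inter> Y i \<and> card (Y' i) = a i"
    "\<forall>i\<in>I. \<forall>y\<in>X'. (a i / card (Y i) - \<alpha> i) * a i \<le> card (N i y \<inter> Y' i)"
    "\<forall>y\<in>X'. (a l / card (Y l) + s * \<alpha> l) * a l \<le> card (N l y \<inter> Y' l)"
proof -
  \<comment> \<open>Trimming every neighbourhood to exactly \<open>a i\<close> points makes the
    inner product of two vectors depend on the size of the intersection alone.\<close>
  have "\<exists>M. \<forall>i\<in>I. \<forall>x\<in>X. M i x \<subseteq> N i x \<inter> Y i \<and> card (M i x) = a i"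
    using a by (intro choice ballI bchoice) (metis obtain_subset_with_card_n)
  then obtain M where M: "\<And>i x. i \<in> I \<Longrightarrow> x \<in> X \<Longrightarrow> M i x \<subseteq> N i x \<inter> Y i"
    "\<And>i x. i \<in> I \<Longrightarrow> x \<in> X \<Longrightarrow> card (M i x) = a i"
    by blast
  define q where "q i = real (a i) / real (card (Y i))" for i
  define u where "u i v x = of_bool (v \<in> M i x) - q i" for i v x
  define W where "W i x y = 1 / (\<alpha> i * real (a i)) * (\<Sum>v\<in>Y i. u i v x * u i v y)" for i x y
  have schur: "schur_multiplier X (W i)" if "i \<in> I" for i
    unfolding W_def using pos[OF that]
    by (intro schur_multiplier_mult schur_multiplier_const schur_multiplier_gram) auto
  have card_M: "(q i + s * \<alpha> i) * a i \<le> card (M i x \<inter> M i y)"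
    if i: "i \<in> I" and xy: "x \<in> X" "y \<in> X" and s: "s \<le> W i x y" for i x y s
  proof -
    have Yi: "0 < real (card (Y i))"
      using pos(2)[OF i] a[OF i xy(1)] Y[OF i] card_mono[of "Y i" "N i x \<inter> Y i"] by simp
    have sub: "M i x \<subseteq> Y i" "M i y \<subseteq> Y i" using M(1)[OF i] xy by auto
    have sums: "(\<Sum>v\<in>Y i. of_bool (v \<in> M i z)) = real (a i)" if "z \<in> X" for z
      using M(1)[OF i that] M(2)[OF i that] Y[OF i]
      by (simp add: of_bool_def sum.If_cases Int_absorb1)
    have "(\<Sum>v\<in>Y i. u i v x * u i v y)
        = (\<Sum>v\<in>Y i. of_bool (v \<in> M i x \<inter> M i y) - q i * of_bool (v \<in> M i x)
            - q i * of_bool (v \<in> M i y) + q i * q i)"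
      by (intro sum.cong) (auto simp: u_def algebra_simps)
    also have "\<dots> = (\<Sum>v\<in>Y i. of_bool (v \<in> M i x \<inter> M i y)) - q i * a i - q i * a i
        + card (Y i) * (q i * q i)"
      by (simp only: sum.distrib sum_subtractf sums[OF xy(1)] sums[OF xy(2)] sum_constant
          flip: sum_distrib_left)
    also have "(\<Sum>v\<in>Y i. of_bool (v \<in> M i x \<inter> M i y)) = real (card (M i x \<inter> M i y))"
    proof -
      have "Y i \<inter> {v. v \<in> M i x \<inter> M i y} = M i x \<inter> M i y" using sub by auto
      then show ?thesis using Y[OF i] by (simp only: of_bool_def sum.If_cases) simp
    qed
    also have "card (Y i) * (q i * q i) = q i * a i" using Yi by (simp add: q_def)
    finally have "W i x y * (\<alpha> i * a i) = card (M i x \<inter> M i y) - q i * a i"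
      using pos[OF i] by (simp add: W_def)
    moreover have "s * (\<alpha> i * a i) \<le> W i x y * (\<alpha> i * a i)"
      using s pos[OF i] by (intro mult_right_mono) auto
    ultimately show ?thesis by (simp add: algebra_simps)
  qed
  obtain l s where ls: "l \<in> I" "- 1 \<le> s"
    and pairs: "corr_const (card I) * exp (- corr_cost (card I) * sqrt (s + 1)) * real (card X) ^ 2
      \<le> card {(x, y) \<in> X \<times> X. (\<forall>i\<in>I. - 1 \<le> W i x y) \<and> s \<le> W l x y}"
  proof (rule exists_correlated_pairs[OF X I])
    show "schur_multiplier X (W i)" if "i \<in> I" for i by (rule schur[OF that])
  qed
  define Z where "Z x = {y \<in> X. (\<forall>i\<in>I. - 1 \<le> W i x y) \<and> s \<le> W l x y}" for x
  define b where "b = corr_const (card I) * exp (- corr_cost (card I) * sqrt (s + 1)) * real (card X)"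
  \<comment> \<open>Averaging over the first coordinate of the good pairs.\<close>
  have "\<exists>x\<in>X. b \<le> card (Z x)"
  proof (rule ccontr)
    assume "\<not> ?thesis"
    then have "(\<Sum>x\<in>X. real (card (Z x))) < (\<Sum>x\<in>X. b)"
      using X by (intro sum_strict_mono) (auto simp: not_le)
    moreover have "{(x, y) \<in> X \<times> X. (\<forall>i\<in>I. - 1 \<le> W i x y) \<and> s \<le> W l x y} = Sigma X Z"
      by (auto simp: Z_def)
    then have "(\<Sum>x\<in>X. real (card (Z x)))
        = card {(x, y) \<in> X \<times> X. (\<forall>i\<in>I. - 1 \<le> W i x y) \<and> s \<le> W l x y}"
      using X by (simp add: card_SigmaI Z_def)
    ultimately show False using pairs by (simp add: b_def power2_eq_square mult_ac)
  qed
  then obtain x where x: "x \<in> X" "b \<le> card (Z x)" by blast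
  have le: "(q i + s' * \<alpha> i) * a i \<le> card (N i y \<inter> M i x)"
    if "i \<in> I" "y \<in> Z x" "s' \<le> W i x y" for i y s'
  proof -
    have y: "y \<in> X" using that by (simp add: Z_def)
    have "M i x \<inter> M i y \<subseteq> N i y \<inter> M i x" using M(1)[OF that(1) y] by auto
    moreover have "finite (M i x)" using M(1)[OF that(1) x(1)] Y[OF that(1)]
      by (blast intro: finite_subset)
    ultimately have "card (M i x \<inter> M i y) \<le> card (N i y \<inter> M i x)" by (intro card_mono) auto
    then show ?thesis using card_M[OF that(1) x(1) y that(3)] by linarith
  qed
  show thesis
  proof (rule that[of x l s "Z x" "\<lambda>i. M i x"])
    show "\<forall>i\<in>I. \<forall>y\<in>Z x. (a i / card (Y i) - \<alpha> i) * a i \<le> card (N i y \<inter> M i x)"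
    proof (intro ballI)
      fix i y assume "i \<in> I" "y \<in> Z x"
      then show "(a i / card (Y i) - \<alpha> i) * a i \<le> card (N i y \<inter> M i x)"
        using le[of i y "- 1"] by (simp add: q_def Z_def)
    qed
    show "\<forall>y\<in>Z x. (a l / card (Y l) + s * \<alpha> l) * a l \<le> card (N l y \<inter> M l x)"
      using le[OF ls(1), of _ s] by (simp add: q_def Z_def)
    show "\<forall>i\<in>I. M i x \<subseteq> N i x \<inter> Y i \<and> card (M i x) = a i" using M x(1) by blast
  qed (use x ls in \<open>auto simp: b_def Z_def\<close>)
qed

section \<open>The book process\<close>

text \<open>Bernoulli is applied to half of the exponent and the result is squared. This keeps the
  excess density above \<open>d / 4\<close> during \<open>t\<close> spine steps.\<close>

lemma quarter_le_power:
  assumes "2 \<le> t" "c \<le> t"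
  shows "1 / 4 \<le> (1 - 1 / real t) ^ c"
proof -
  have "1 / 4 \<le> (1 - 1 / real t) ^ t"
  proof -
    have h: "1 / 2 \<le> (1 - 1 / real t) ^ k" if "real k \<le> real t / 2" for k
    proof -
      have "1 + real k * (- (1 / real t)) \<le> (1 + - (1 / real t)) ^ k"
        using assms by (intro Bernoulli_inequality) simp
      moreover have "real k / real t \<le> 1 / 2" using that assms by (simp add: divide_le_eq)
      ultimately show ?thesis by simp
    qed
    show ?thesis
    proof (cases "even t")
      case True
      then obtain k where k: "t = 2 * k" by (elim evenE)
      have "1 / 2 \<le> (1 - 1 / real t) ^ k" using k by (intro h) simp
      moreover have "(1 - 1 / real t) ^ t = (1 - 1 / real t) ^ k * (1 - 1 / real t) ^ k"
        by (subst (2) k) (simp add: mult_2 power_add)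
      ultimately show ?thesis
        using mult_mono[of "1 / 2" "(1 - 1 / real t) ^ k" "1 / 2" "(1 - 1 / real t) ^ k"]
        by simp
    next
      case False
      then obtain k where k: "t = 2 * k + 1" by (elim oddE)
      let ?u = "1 - 1 / real t"
      have "0 < ?u" using assms by simp
      have "(1 - real k / real t)\<^sup>2 * ?u \<le> (?u ^ k)\<^sup>2 * ?u"
      proof (intro mult_right_mono power_mono)
        show "1 - real k / real t \<le> ?u ^ k"
          using Bernoulli_inequality[of "- (1 / real t)" k] assms by simp
      qed (use k assms in \<open>auto simp: divide_le_eq\<close>)
      also have "(?u ^ k)\<^sup>2 * ?u = ?u ^ t" by (simp add: k power_even_eq)
      finally have *: "(1 - real k / real t)\<^sup>2 * ?u \<le> ?u ^ t" .
      have "1 \<le> k" using k assms by simp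
      \<comment> \<open>For \<open>t = 2 * k + 1\<close> the lower bound is a product of two factors
        \<open>(k + 1) / t\<close> and one factor \<open>2 * k / t\<close>; clearing
        \<open>t ^ 3\<close> leaves this cubic inequality.\<close>
      have "1 / 4 * (2 * real k + 1) ^ 3 \<le> (real k + 1)\<^sup>2 * (2 * real k)"
      proof -
        have "1 \<le> real k * real k" using \<open>1 \<le> k\<close> by (metis mult_le_mono of_nat_1 of_nat_le_iff of_nat_mult nat_mult_1)
        moreover have "real k * real k \<le> real k * real k * real k" using \<open>1 \<le> k\<close> by simp
        ultimately show ?thesis using \<open>1 \<le> k\<close> by (simp add: power2_eq_square power3_eq_cube algebra_simps)
      qed
      moreover have "(1 - real k / real t)\<^sup>2 * ?u = (real k + 1)\<^sup>2 * (2 * real k) / (2 * real k + 1) ^ 3"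
        by (simp add: k power2_eq_square power3_eq_cube field_simps)
      ultimately have "1 / 4 \<le> (1 - real k / real t)\<^sup>2 * ?u" by (simp add: pos_le_divide_eq)
      with * show ?thesis by linarith
    qed
  qed
  also have "\<dots> \<le> (1 - 1 / real t) ^ c" using assms by (intro power_decreasing) auto
  finally show ?thesis .
qed

lemma divide_le_ln_one_plus:
  assumes "0 \<le> s" "0 < t"
  shows "s / (t + s) \<le> ln (1 + s / t :: real)"
proof -
  have "0 < 1 + s / t" using assms by (simp add: add_pos_nonneg)
  then have "- ln (1 + s / t) \<le> 1 / (1 + s / t) - 1"
    using ln_le_minus_one[of "1 / (1 + s / t)"] by (simp add: ln_div)
  also have "\<dots> = - (s / (t + s))" using assms by (simp add: field_simps)
  finally show ?thesis by simp
qed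

text \<open>\<open>p - d\<close> is a density that is never undercut, \<open>L\<close> is the least \<open>\<lambda>\<close> for which a step is a density
  boost, \<open>cX\<close> is the loss in \<open>ln |X|\<close> per spine vertex, and \<open>bX\<close> the loss per unit of boost.\<close>

locale book_process =
  fixes n r t m :: nat and \<chi> :: "nat set \<Rightarrow> nat" and X\<^sub>0 :: "nat set" and Y\<^sub>0 :: "nat \<Rightarrow> nat set"
    and p d L cX bX :: real
  assumes r: "1 \<le> r" and t: "2 \<le> t" and m: "1 \<le> m"
    and colouring: "edge_colouring n r \<chi>"
    and X\<^sub>0: "X\<^sub>0 \<subseteq> Kn_verts n" "X\<^sub>0 \<noteq> {}"
    and Y\<^sub>0: "\<And>i. i \<in> {1..r} \<Longrightarrow> Y\<^sub>0 i \<subseteq> Kn_verts n" "\<And>i. i \<in> {1..r} \<Longrightarrow> Y\<^sub>0 i \<noteq> {}"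
    and p: "0 < d" "d < p" "p \<le> 1"
    and dens\<^sub>0: "\<And>x i. x \<in> X\<^sub>0 \<Longrightarrow> i \<in> {1..r} \<Longrightarrow>
      p * real (card (Y\<^sub>0 i)) \<le> real (card (col_nbhd n \<chi> i x \<inter> Y\<^sub>0 i))"
    and L: "1 \<le> L"
    and cX: "ln (2 * real r / corr_const r) + corr_cost r * sqrt (L + 1) \<le> cX"
    and bX: "\<And>s. L \<le> s \<Longrightarrow> s \<le> 4 * real t / d \<Longrightarrow>
      ln (1 / corr_const r) + corr_cost r * sqrt (s + 1) \<le> bX * ln (1 + s / t)" "0 \<le> bX"
    and large_X: "cX * (real r * real t + 1) + bX * (real r * ln (4 / d)) \<le> ln (card X\<^sub>0)"
    and large_Y: "\<And>i. i \<in> {1..r} \<Longrightarrow>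
      ln m + ln (1 / (p - d)) * (real t + ln (4 / d) * (1 + t / L)) \<le> ln (card (Y\<^sub>0 i))"
begin

abbreviation "N \<equiv> col_nbhd n \<chi>"

text \<open>The guaranteed surplus of the density over \<open>p - d\<close>: each of
  \<open>c\<close> spine vertices costs a factor \<open>1 - 1 / t\<close>, and boosts multiply to
  \<open>exp b\<close>. It starts at \<open>d\<close>, so the initial guarantee is
  \<open>p\<close>.\<close>

definition excess :: "nat \<Rightarrow> real \<Rightarrow> real" where
  "excess c b = d * (1 - 1 / t) ^ c * exp b"

text \<open>\<open>T i\<close> is the set of spine vertices collected in colour \<open>i\<close>, and \<open>b i\<close> is the sum
  of \<open>ln (1 + \<lambda> / t)\<close> over all density boosts by \<open>\<lambda>\<close> in colour \<open>i\<close>.\<close>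

definition colour_inv ::
    "nat \<Rightarrow> nat set \<Rightarrow> nat set \<Rightarrow> nat set \<Rightarrow> real \<Rightarrow> bool" where
  "colour_inv i X Y T b \<longleftrightarrow> Y \<subseteq> Kn_verts n \<and> Y \<noteq> {} \<and> T \<subseteq> Kn_verts n \<and> card T \<le> t \<and> 0 \<le> b \<and>
    (\<forall>x\<in>T. X \<union> Y \<subseteq> N i x) \<and> (\<forall>x\<in>T. \<forall>y\<in>T. x \<noteq> y \<longrightarrow> \<chi> {x, y} = i) \<and>
    (\<forall>x\<in>X. (p - d + excess (card T) b) * card Y \<le> card (N i x \<inter> Y)) \<and>
    ln (card (Y\<^sub>0 i)) \<le> ln (1 / (p - d)) * (card T + b * (1 + t / L)) + ln (card Y)"

definition process_inv ::
    "nat set \<Rightarrow> (nat \<Rightarrow> nat set) \<Rightarrow> (nat \<Rightarrow> nat set) \<Rightarrow> (nat \<Rightarrow> real) \<Rightarrow> bool" where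
  "process_inv X Y T b \<longleftrightarrow> X \<subseteq> Kn_verts n \<and> X \<noteq> {} \<and>
    ln (card X\<^sub>0) \<le> cX * (\<Sum>i=1..r. real (card (T i))) + bX * (\<Sum>i=1..r. b i) + ln (card X) \<and>
    (\<forall>i\<in>{1..r}. colour_inv i X (Y i) (T i) (b i))"

text \<open>Bounds the number of steps: a spine step adds 1, and a boost by at least
  \<open>L\<close> adds at least \<open>ln (1 + L / t)\<close> to the second sum.\<close>

definition progress :: "(nat \<Rightarrow> nat set) \<Rightarrow> (nat \<Rightarrow> real) \<Rightarrow> real" where
  "progress T b = (\<Sum>i=1..r. real (card (T i))) + (\<Sum>i=1..r. b i) / ln (1 + L / t)"

section \<open>Consequences of the invariant\<close>

lemma process_invD:
  assumes "process_inv X Y T b"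
  shows "X \<subseteq> Kn_verts n" "X \<noteq> {}"
    "ln (card X\<^sub>0) \<le> cX * (\<Sum>i=1..r. real (card (T i))) + bX * (\<Sum>i=1..r. b i) + ln (card X)"
    "i \<in> {1..r} \<Longrightarrow> colour_inv i X (Y i) (T i) (b i)"
  using assms unfolding process_inv_def by blast+

lemma colour_invD:
  assumes "colour_inv i X Y T b"
  shows "Y \<subseteq> Kn_verts n" "Y \<noteq> {}" "T \<subseteq> Kn_verts n" "card T \<le> t" "0 \<le> b"
    "x \<in> T \<Longrightarrow> X \<subseteq> N i x" "x \<in> T \<Longrightarrow> Y \<subseteq> N i x"
    "x \<in> T \<Longrightarrow> y \<in> T \<Longrightarrow> x \<noteq> y \<Longrightarrow> \<chi> {x, y} = i"
    "x \<in> X \<Longrightarrow> (p - d + excess (card T) b) * card Y \<le> card (N i x \<inter> Y)"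
    "ln (card (Y\<^sub>0 i)) \<le> ln (1 / (p - d)) * (card T + b * (1 + t / L)) + ln (card Y)"
  using assms unfolding colour_inv_def by simp_all

lemma finite_verts: "A \<subseteq> Kn_verts n \<Longrightarrow> finite A"
  by (auto simp: Kn_verts_def intro: finite_subset)

lemma excess_ge: "c \<le> t \<Longrightarrow> 0 \<le> b \<Longrightarrow> d / 4 \<le> excess c b"
  using quarter_le_power[OF t, of c] p(1) mult_mono[of "1 / 4" "(1 - 1 / t) ^ c" 1 "exp b"]
  by (auto simp: excess_def mult.assoc)

lemma colour_inv_card_pos: "colour_inv i X Y T b \<Longrightarrow> 0 < card Y"
  using colour_invD(1,2) finite_verts by (simp add: card_gt_0_iff)

text \<open>A density is at most 1, and spine vertices reduce the excess by a factor of at least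
  \<open>1 / 4\<close> in total, so \<open>d / 4 * exp (b i) \<le> 1\<close>.\<close>

lemma boost_le:
  assumes inv: "process_inv X Y T b" and i: "i \<in> {1..r}"
  shows "b i \<le> ln (4 / d)"
proof -
  obtain x where x: "x \<in> X" using process_invD(2)[OF inv] by auto
  note ci = process_invD(4)[OF inv i]
  have Y: "finite (Y i)" "0 < card (Y i)"
    using colour_invD(1)[OF ci] colour_inv_card_pos[OF ci] finite_verts by auto
  have "(p - d + excess (card (T i)) (b i)) * card (Y i) \<le> card (N i x \<inter> Y i)"
    by (rule colour_invD(9)[OF ci x])
  also have "\<dots> \<le> 1 * card (Y i)" using Y by (simp add: card_mono)
  finally have "p - d + excess (card (T i)) (b i) \<le> 1" using Y by simp
  moreover have "1 / 4 \<le> (1 - 1 / real t) ^ card (T i)"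
    using colour_invD(4)[OF ci] by (rule quarter_le_power[OF t])
  then have "d * (1 / 4) * exp (b i) \<le> excess (card (T i)) (b i)"
    unfolding excess_def using p by (intro mult_right_mono mult_left_mono) auto
  ultimately have "d * (1 / 4) * exp (b i) \<le> 1" using p by linarith
  then have "exp (b i) \<le> 4 / d" using p by (simp add: field_simps)
  then show ?thesis using p by (simp add: ln_ge_iff)
qed

lemma ln_inv_pos: "0 < ln (1 / (p - d))" "1 \<le> 1 / (p - d)"
  using p by auto

lemma ln_boost_pos: "L \<le> s \<Longrightarrow> 0 < ln (1 + s / t)"
  using L t by (intro ln_gt_zero) simp

lemma large_Y_inv:
  assumes inv: "process_inv X Y T b" and i: "i \<in> {1..r}"
  shows "m \<le> card (Y i)"
proof -
  note ci = process_invD(4)[OF inv i]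
  have "ln (1 / (p - d)) * (card (T i) + b i * (1 + t / L))
      \<le> ln (1 / (p - d)) * (real t + ln (4 / d) * (1 + t / L))"
    using colour_invD(4)[OF ci] boost_le[OF inv i] L less_imp_le[OF ln_inv_pos(1)]
    by (intro mult_left_mono add_mono mult_right_mono) auto
  then have "ln m \<le> ln (card (Y i))"
    using large_Y[OF i] colour_invD(10)[OF ci] by linarith
  then show ?thesis using m colour_inv_card_pos[OF ci] by simp
qed

lemma sum_card_le:
  "process_inv X Y T b \<Longrightarrow> (\<Sum>i=1..r. real (card (T i))) \<le> real r * real t"
  using sum_mono[of "{1..r}" "\<lambda>i. real (card (T i))" "\<lambda>_. real t"] colour_invD(4)[OF process_invD(4)]
  by simp

lemma sum_boost_le: "process_inv X Y T b \<Longrightarrow> (\<Sum>i=1..r. b i) \<le> real r * ln (4 / d)"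
  using sum_mono[of "{1..r}" b "\<lambda>_. ln (4 / d)"] boost_le by simp

text \<open>The budget of \<open>large_X\<close> covers \<open>r * t + 1\<close> spine vertices, but
  at most \<open>r * t\<close> have been paid for; the remainder finances one further spine
  step.\<close>

lemma large_X_inv:
  assumes inv: "process_inv X Y T b"
  shows "cX \<le> ln (card X)"
proof -
  have "0 < ln (2 * real r / corr_const r)"
  proof (intro ln_gt_zero)
    have "0 < corr_const r" "corr_const r \<le> 1" by (auto simp: corr_const_def power_le_one)
    then show "1 < 2 * real r / corr_const r" using r by (simp add: less_divide_eq)
  qed
  moreover have "0 \<le> corr_cost r * sqrt (L + 1)" using L by (simp add: corr_cost_def)
  ultimately have "0 \<le> cX" using cX by linarith
  then have "cX * (\<Sum>i=1..r. real (card (T i))) + bX * (\<Sum>i=1..r. b i)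
      \<le> cX * (real r * real t) + bX * (real r * ln (4 / d))"
    using bX(2) sum_card_le[OF inv] sum_boost_le[OF inv] by (intro add_mono mult_left_mono) auto
  then show ?thesis using large_X process_invD(3)[OF inv] by (simp add: algebra_simps)
qed

lemma progress_le:
  assumes inv: "process_inv X Y T b"
  shows "progress T b \<le> real r * real t + real r * ln (4 / d) / ln (1 + L / t)"
  unfolding progress_def using ln_boost_pos[of L] sum_card_le[OF inv] sum_boost_le[OF inv]
  by (intro add_mono divide_right_mono) auto

lemma process_inv_initial: "process_inv X\<^sub>0 Y\<^sub>0 (\<lambda>_. {}) (\<lambda>_. 0)"
  using X\<^sub>0 Y\<^sub>0 dens\<^sub>0 by (simp add: process_inv_def colour_inv_def excess_def)

lemma contains_book_of_inv:
  assumes inv: "process_inv X Y T b" and i: "i \<in> {1..r}" and T: "card (T i) = t"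
  shows "contains_mono_book n r \<chi> t m"
proof -
  note ci = process_invD(4)[OF inv i]
  obtain B where B: "B \<subseteq> Y i" "card B = m" "finite B"
    using large_Y_inv[OF inv i] obtain_subset_with_card_n by metis
  note sub = colour_invD(1,3)[OF ci]
  have TY: "x \<noteq> y \<and> \<chi> {x, y} = i" if "x \<in> T i" "y \<in> Y i" for x y
    using colour_invD(7)[OF ci that(1)] that(2) by (auto simp: col_nbhd_def)
  have "\<chi> e = i" if e: "e \<in> book_edges (T i) B" for e
  proof -
    obtain x y where xy: "e = {x, y}" "x \<noteq> y"
      using e by (auto simp: book_edges_def nsets_def card_2_iff)
    with e have "x \<in> T i \<and> y \<in> T i \<or> x \<in> T i \<and> y \<in> B \<or> x \<in> B \<and> y \<in> T i"
      by (auto simp: book_edges_def nsets_def)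
    then show ?thesis
      using colour_invD(8)[OF ci, of x y] TY[of x y] TY[of y x] B(1) xy
      by (auto simp: insert_commute)
  qed
  moreover have "T i \<inter> B = {}" using TY B by blast
  ultimately show ?thesis
    unfolding contains_mono_book_def is_book_def using i sub B T finite_verts
    by (intro bexI[of _ i] exI[of _ "T i"] exI[of _ B]) auto
qed

section \<open>Preservation of the invariant\<close>

lemma ln_card_shrink:
  assumes Y: "0 < card Y" and Y': "(p - d) * card Y \<le> card Y'"
  shows "ln (card Y) \<le> ln (1 / (p - d)) + ln (card Y')"
proof -
  have "0 < (p - d) * card Y" using Y p by simp
  then have "ln ((p - d) * card Y) \<le> ln (card Y')" using Y' by simp
  then show ?thesis using Y p by (simp add: ln_mult ln_div)
qed

lemma colour_inv_subset: "colour_inv i X Y T b \<Longrightarrow> X' \<subseteq> X \<Longrightarrow> colour_inv i X' Y T b"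
  unfolding colour_inv_def by blast

lemma colour_inv_extend:
  assumes inv: "colour_inv i X Y T b" and T: "card T < t"
    and x: "x \<in> X" "X \<subseteq> Kn_verts n" and X': "X' \<subseteq> X \<inter> N i x" and Y': "Y' \<subseteq> N i x \<inter> Y"
    and card: "0 < card Y'" "(p - d) * card Y \<le> card Y'"
    and dens: "\<And>y. y \<in> X' \<Longrightarrow>
      (p - d + excess (card T) b * (1 - 1 / t)) * card Y' \<le> card (N i y \<inter> Y')"
  shows "colour_inv i X' Y' (insert x T) b" "card (insert x T) = Suc (card T)"
proof -
  \<comment> \<open>All of \<open>X\<close> lies in the neighbourhood of each spine vertex; a spine
    vertex in \<open>X\<close> would be its own neighbour.\<close>
  have nx: "x \<notin> T" using colour_invD(6)[OF inv, of x] x by (auto simp: col_nbhd_def)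
  have fin: "finite T" using colour_invD(3)[OF inv] by (rule finite_verts)
  show cT: "card (insert x T) = Suc (card T)" using nx fin by simp
  have col: "\<chi> {y, x} = i" if "y \<in> T" for y
    using colour_invD(6)[OF inv that] x by (auto simp: col_nbhd_def)
  have "ln (card Y) \<le> ln (1 / (p - d)) + ln (card Y')"
    using colour_inv_card_pos[OF inv] card(2) by (rule ln_card_shrink)
  with colour_invD(10)[OF inv]
  have "ln (card (Y\<^sub>0 i)) \<le> ln (1 / (p - d)) * (card (insert x T) + b * (1 + t / L)) + ln (card Y')"
    by (simp add: cT algebra_simps)
  moreover have "excess (card (insert x T)) b = excess (card T) b * (1 - 1 / t)"
    by (simp add: cT excess_def mult_ac)
  ultimately show "colour_inv i X' Y' (insert x T) b"
    unfolding colour_inv_def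
  proof (intro conjI ballI impI)
    show "Y' \<noteq> {}" using card by auto
    show "X' \<union> Y' \<subseteq> N i y" if "y \<in> insert x T" for y
      using that X' Y' colour_invD(6,7)[OF inv, of y] by blast
    show "\<chi> {y, z} = i" if "y \<in> insert x T" "z \<in> insert x T" "y \<noteq> z" for y z
      using that col[of y] col[of z] colour_invD(8)[OF inv, of y z] by (auto simp: doubleton_eq_iff)
        (metis insert_commute)
  qed (use Y' x T dens cT colour_invD(1,3,4,5)[OF inv] in auto)
qed

lemma colour_inv_boost:
  assumes inv: "colour_inv i X Y T b" and s: "L \<le> s" and X': "X' \<subseteq> X" and Y': "Y' \<subseteq> Y"
    and card: "0 < card Y'" "(p - d) * card Y \<le> card Y'"
    and dens: "\<And>y. y \<in> X' \<Longrightarrow>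
      (p - d + excess (card T) b * (1 + s / t)) * card Y' \<le> card (N i y \<inter> Y')"
  shows "colour_inv i X' Y' T (b + ln (1 + s / t))"
proof -
  have st: "0 < 1 + s / t" "0 < 1 + L / t" using s L t by (simp_all add: add_pos_nonneg)
  have lnb: "0 < ln (1 + s / t)" by (rule ln_boost_pos[OF s])
  \<comment> \<open>The reservoir shrinks once per boost, by a factor of at least
    \<open>p - d\<close>. The increase of \<open>b\<close> pays for it, as
    \<open>ln (1 + s / t) \<ge> L / (t + L) = 1 / (1 + t / L)\<close>.\<close>
  have "1 \<le> ln (1 + s / t) * (1 + t / L)"
  proof -
    have "1 / (1 + t / L) = L / (t + L)" using L t by (simp add: field_simps)
    also have "\<dots> \<le> ln (1 + L / t)" using L t by (intro divide_le_ln_one_plus) auto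
    also have "ln (1 + L / t) \<le> ln (1 + s / t)"
      using st s by (simp add: divide_right_mono)
    finally show ?thesis using L by (simp add: divide_le_eq add_pos_nonneg)
  qed
  then have "ln (1 / (p - d)) * 1 \<le> ln (1 / (p - d)) * (ln (1 + s / t) * (1 + t / L))"
    using ln_inv_pos by (intro mult_left_mono) auto
  moreover have "ln (card Y) \<le> ln (1 / (p - d)) + ln (card Y')"
    using colour_inv_card_pos[OF inv] card(2) by (rule ln_card_shrink)
  ultimately have "ln (card (Y\<^sub>0 i))
      \<le> ln (1 / (p - d)) * (card T + (b + ln (1 + s / t)) * (1 + t / L)) + ln (card Y')"
    using colour_invD(10)[OF inv] by (simp add: distrib_left distrib_right add_divide_distrib)
  moreover have "excess (card T) (b + ln (1 + s / t)) = excess (card T) b * (1 + s / t)"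
    using st by (simp add: excess_def exp_add mult_ac)
  ultimately show ?thesis
    unfolding colour_inv_def
  proof (intro conjI ballI impI)
    show "Y' \<noteq> {}" using card by auto
    show "X' \<union> Y' \<subseteq> N i y" if "y \<in> T" for y
      using that X' Y' colour_invD(6,7)[OF inv, of y] by blast
  qed (use Y' dens lnb colour_invD(1,3,4,5,8)[OF inv] in auto)
qed

text \<open>Pigeonhole over the colours at \<open>x\<close>, which cover \<open>X - {x}\<close>; the
  factor 2 absorbs the possible loss of \<open>x\<close>.\<close>

lemma exists_popular_colour:
  assumes X: "X \<subseteq> Kn_verts n" and x: "x \<in> Kn_verts n" and two: "2 \<le> card X"
  shows "\<exists>j\<in>{1..r}. real (card X) \<le> 2 * real r * card (X \<inter> N j x)"
proof (rule ccontr)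
  assume neg: "\<not> ?thesis"
  have unpop: "2 * real r * card (X \<inter> N j x) < card X" if "j \<in> {1..r}" for j
    using neg that by (meson not_le)
  have "X - {x} \<subseteq> (\<Union>j\<in>{1..r}. X \<inter> N j x)"
  proof
    fix y assume y: "y \<in> X - {x}"
    then have "{x, y} \<in> Kn_edges n" using x X by (auto simp: Kn_edges_def nsets_def)
    then have "\<chi> {x, y} \<in> {1..r}" using colouring by (auto simp: edge_colouring_def)
    then show "y \<in> (\<Union>j\<in>{1..r}. X \<inter> N j x)" using y X by (auto simp: col_nbhd_def)
  qed
  then have "card (X - {x}) \<le> card (\<Union>j\<in>{1..r}. X \<inter> N j x)"
    using X by (intro card_mono) (auto intro: finite_verts)
  also have "\<dots> \<le> (\<Sum>j\<in>{1..r}. card (X \<inter> N j x))" by (intro card_UN_le) simp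
  finally have "2 * real r * card (X - {x}) \<le> 2 * real r * real (\<Sum>j\<in>{1..r}. card (X \<inter> N j x))"
    by (intro mult_left_mono of_nat_mono) auto
  also have "\<dots> = (\<Sum>j\<in>{1..r}. 2 * real r * card (X \<inter> N j x))"
    by (simp add: sum_distrib_left)
  also have "\<dots> < (\<Sum>j\<in>{1..r}. real (card X))"
    using unpop r by (intro sum_strict_mono) auto
  also have "\<dots> = real r * card X" by simp
  finally have "2 * real (card (X - {x})) < card X" using r by simp
  moreover have "real (card X) \<le> 2 * real (card (X - {x}))"
    using two by (cases "x \<in> X") (auto simp: card_Diff_singleton_if)
  ultimately show False by linarith
qed

section \<open>A single step of the process\<close>

lemma process_step:
  assumes inv: "process_inv X Y T b" and T: "\<And>i. i \<in> {1..r} \<Longrightarrow> card (T i) < t"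
  obtains X' Y' T' b' where "process_inv X' Y' T' b'" "progress T b + 1 \<le> progress T' b'"
proof -
  note ci = process_invD(4)[OF inv]
  define a where "a i = Min ((\<lambda>x. card (N i x \<inter> Y i)) ` X)" for i
  define e where "e i = excess (card (T i)) (b i)" for i
  define q where "q i = real (a i) / card (Y i)" for i
  \<comment> \<open>With this scale
    \<open>q i + s * \<alpha> i = p - d + (q i - p + d) * (1 + s / t)\<close>, so a correlation
    \<open>s\<close> multiplies the excess by \<open>1 + s / t\<close>, and -1 gives the loss
    \<open>1 - 1 / t\<close>.\<close>
  define \<alpha> where "\<alpha> i = (q i - p + d) / t" for i
  have X: "finite X" "X \<noteq> {}" "X \<subseteq> Kn_verts n"
    using process_invD[OF inv] by (auto intro: finite_verts)
  have Ypos: "0 < card (Y i)" if "i \<in> {1..r}" for i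
    using colour_inv_card_pos[OF ci[OF that]] .
  have a_le: "a i \<le> card (N i x \<inter> Y i)" if "x \<in> X" for i x
    unfolding a_def using X that by (intro Min_le) auto
  have e: "d / 4 \<le> e i" if "i \<in> {1..r}" for i
    unfolding e_def using colour_invD(4,5)[OF ci[OF that]] by (rule excess_ge)
  have q_ge: "p - d + e i \<le> q i" if i: "i \<in> {1..r}" for i
  proof -
    have "a i \<in> (\<lambda>x. card (N i x \<inter> Y i)) ` X" unfolding a_def using X by (intro Min_in) auto
    then obtain x where "x \<in> X" "a i = card (N i x \<inter> Y i)" by auto
    then show ?thesis
      using colour_invD(9)[OF ci[OF i], of x] Ypos[OF i] by (simp add: q_def e_def pos_le_divide_eq)
  qed
  have q_mult: "q i * card (Y i) = a i" if "i \<in> {1..r}" for i using Ypos[OF that] by (simp add: q_def)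
  have a_ge: "(p - d) * card (Y i) \<le> a i" "0 < a i" if i: "i \<in> {1..r}" for i
  proof -
    have "(p - d) * card (Y i) \<le> q i * card (Y i)"
      using q_ge[OF i] e[OF i] p by (intro mult_right_mono) auto
    then show "(p - d) * card (Y i) \<le> a i" using q_mult[OF i] by simp
    moreover have "0 < (p - d) * card (Y i)" using p Ypos[OF i] by simp
    ultimately show "0 < a i" by linarith
  qed
  have \<alpha>: "e i / t \<le> \<alpha> i" "0 < \<alpha> i" if i: "i \<in> {1..r}" for i
    using q_ge[OF i] e[OF i] p t unfolding \<alpha>_def
    by (auto intro!: divide_right_mono divide_pos_pos)
  obtain x l s Z W where x: "x \<in> X" and l: "l \<in> {1..r}" and s: "- 1 \<le> s" and Z: "Z \<subseteq> X"
    and Z_card: "corr_const (card {1..r}) * exp (- corr_cost (card {1..r}) * sqrt (s + 1)) * real (card X)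
      \<le> card Z"
    and W0: "\<forall>i\<in>{1..r}. W i \<subseteq> N i x \<inter> Y i \<and> card (W i) = a i"
    and W_low: "\<forall>i\<in>{1..r}. \<forall>y\<in>Z. (a i / card (Y i) - \<alpha> i) * a i \<le> card (N i y \<inter> W i)"
    and W_high: "\<forall>y\<in>Z. (a l / card (Y l) + s * \<alpha> l) * a l \<le> card (N l y \<inter> W l)"
  proof (rule exists_dense_step[of X "{1..r}" Y \<alpha> a N])
    show "finite (Y i)" if "i \<in> {1..r}" for i
      using colour_invD(1)[OF ci[OF that]] by (rule finite_verts)
    show "{1..r} \<noteq> {}" using r by simp
    show "a i \<le> card (N i x \<inter> Y i)" if "x \<in> X" for i x by (rule a_le[OF that])
    show "0 < \<alpha> i" "0 < a i" if "i \<in> {1..r}" for i using \<alpha> a_ge that by auto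
    show "finite X" "X \<noteq> {}" by (fact X)+
    show "finite {1..r}" by simp
  qed
  have W: "W i \<subseteq> N i x \<inter> Y i" "card (W i) = a i" if "i \<in> {1..r}" for i
    using W0 that by blast+
  have cardX: "0 < card X" using X by (simp add: card_gt_0_iff)
  have Z_pos: "0 < card Z"
  proof -
    have "0 < corr_const r * exp (- corr_cost r * sqrt (s + 1)) * real (card X)"
      using corr_const_pos cardX by simp
    then have "0 < real (card Z)" using Z_card by simp
    then show ?thesis by simp
  qed
  have Z_ln: "ln (card X) \<le> ln (1 / corr_const r) + corr_cost r * sqrt (s + 1) + ln (card Z)"
  proof -
    have "0 < corr_const r * exp (- corr_cost r * sqrt (s + 1)) * real (card X)"
      using corr_const_pos cardX by simp
    then have "ln (corr_const r * exp (- corr_cost r * sqrt (s + 1)) * real (card X)) \<le> ln (card Z)"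
      using Z_card by simp
    then show ?thesis using corr_const_pos[of r] cardX by (simp add: ln_mult ln_div)
  qed
  have Z_sub: "Z \<subseteq> Kn_verts n" using Z X by auto
  have upd: "(\<Sum>i=1..r. (g(j := y)) i) = (\<Sum>i=1..r. g i) + (y - g j)"
    if "j \<in> {1..r}" for g :: "nat \<Rightarrow> real" and j y
  proof -
    have "(\<Sum>i\<in>{1..r} - {j}. (g(j := y)) i) = (\<Sum>i\<in>{1..r} - {j}. g i)"
      by (intro sum.cong) auto
    then show ?thesis
      using sum.remove[OF finite_atLeastAtMost that, of g]
        sum.remove[OF finite_atLeastAtMost that, of "g(j := y)"] by simp
  qed
  show thesis
  proof (cases "L \<le> s")
    case True
    define b' where "b' = b(l := b l + ln (1 + s / t))"
    have "e l * (1 + s / t) \<le> (q l - p + d) * (1 + s / t)"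
      using q_ge[OF l] True L t by (intro mult_right_mono) (auto simp: add_nonneg_nonneg)
    then have boost: "p - d + e l * (1 + s / t) \<le> q l + s * \<alpha> l"
      by (simp add: \<alpha>_def algebra_simps add_divide_distrib diff_divide_distrib)
    \<comment> \<open>The cost bound \<open>bX\<close> covers only this range. A larger
      \<open>s\<close> would push the density in colour \<open>l\<close> above 1, because
      \<open>\<alpha> l \<ge> d / (4 * t)\<close>.\<close>
    have "s \<le> 4 * real t / d"
    proof -
      obtain y where y: "y \<in> Z" using Z_pos by fastforce
      have "(q l + s * \<alpha> l) * a l \<le> card (N l y \<inter> W l)"
        using bspec[OF W_high y] by (simp add: q_def)
      also have "\<dots> \<le> card (W l)"
        using W(1)[OF l] colour_invD(1)[OF ci[OF l]]
        by (intro of_nat_mono card_mono) (auto intro!: finite_verts)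
      also have "\<dots> = 1 * a l" using W(2)[OF l] by simp
      finally have "q l + s * \<alpha> l \<le> 1" using a_ge(2)[OF l] by simp
      then have "s * \<alpha> l \<le> 1" using q_ge[OF l] e[OF l] p by linarith
      moreover have "d / 4 / t \<le> e l / t" using e[OF l] by (intro divide_right_mono) auto
      then have "s * (d / 4 / t) \<le> s * \<alpha> l"
        using \<alpha>(1)[OF l] True L by (intro mult_left_mono) auto
      ultimately have "s * (d / 4 / t) \<le> 1" by linarith
      then show ?thesis using p t by (simp add: field_simps)
    qed
    then have cost: "ln (1 / corr_const r) + corr_cost r * sqrt (s + 1) \<le> bX * ln (1 + s / t)"
      by (rule bX(1)[OF True])
    have "process_inv Z (Y(l := W l)) T b'"
      unfolding process_inv_def
    proof (intro conjI ballI)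
      show "Z \<noteq> {}" using Z_pos by auto
      show "ln (card X\<^sub>0) \<le> cX * (\<Sum>i=1..r. real (card (T i))) + bX * (\<Sum>i=1..r. b' i) + ln (card Z)"
        using process_invD(3)[OF inv] Z_ln cost unfolding b'_def upd[OF l]
        by (simp add: algebra_simps)
      fix i assume i: "i \<in> {1..r}"
      show "colour_inv i Z ((Y(l := W l)) i) (T i) (b' i)"
      proof (cases "i = l")
        case True
        have "colour_inv l Z (W l) (T l) (b l + ln (1 + s / t))"
        proof (rule colour_inv_boost[OF ci[OF l] \<open>L \<le> s\<close> Z])
          fix y assume y: "y \<in> Z"
          have "(p - d + e l * (1 + s / t)) * a l \<le> (q l + s * \<alpha> l) * a l"
            using boost by (intro mult_right_mono) auto
          also have "\<dots> \<le> card (N l y \<inter> W l)" using bspec[OF W_high y] by (simp add: q_def)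
          finally show "(p - d + excess (card (T l)) (b l) * (1 + s / t)) * card (W l)
              \<le> card (N l y \<inter> W l)"
            by (simp add: W(2)[OF l] e_def)
        qed (use W[OF l] a_ge[OF l] in auto)
        then show ?thesis using True by (simp add: b'_def)
      next
        case False
        then show ?thesis using colour_inv_subset[OF ci[OF i] Z] by (simp add: b'_def)
      qed
    qed (rule Z_sub)
    moreover have "progress T b + 1 \<le> progress T b'"
    proof -
      have "0 < 1 + L / t" "0 < 1 + s / t" using L t True by (simp_all add: add_pos_nonneg)
      then have "ln (1 + L / t) \<le> ln (1 + s / t)" using True by (simp add: divide_right_mono)
      then have "1 \<le> ln (1 + s / t) / ln (1 + L / t)" using ln_boost_pos[of L] by simp
      then show ?thesis unfolding progress_def b'_def upd[OF l] by (simp add: add_divide_distrib)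
    qed
    ultimately show thesis by (rule that)
  next
    case False
    have "corr_cost r * sqrt (s + 1) \<le> corr_cost r * sqrt (L + 1)"
      using False by (intro mult_left_mono) (auto simp: corr_cost_def)
    then have cost: "ln (1 / corr_const r) + corr_cost r * sqrt (s + 1) + ln (2 * real r) \<le> cX"
      using cX corr_const_pos[of r] r by (simp add: ln_div ln_mult)
    \<comment> \<open>The reserve \<open>cX\<close> exceeds the loss from \<open>X\<close> to
      \<open>Z\<close> by \<open>ln (2 * r)\<close>, so \<open>Z\<close> has the two vertices needed
      for a popular colour.\<close>
    then have "ln (2 * real r) \<le> ln (card Z)" using large_X_inv[OF inv] Z_ln by linarith
    then have "2 * real r \<le> card Z" using Z_pos r by simp
    then have "2 \<le> card Z" using r by linarith
    then obtain j where j: "j \<in> {1..r}" and pop: "real (card Z) \<le> 2 * real r * card (Z \<inter> N j x)"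
      using exists_popular_colour[OF Z_sub] x X by blast
    define X' where "X' = Z \<inter> N j x"
    define T' where "T' = T(j := insert x (T j))"
    have X'_pos: "0 < card X'" using pop Z_pos by (cases "card X' = 0") (auto simp: X'_def)
    have sub: "X' \<subseteq> X \<inter> N j x" "W j \<subseteq> N j x \<inter> Y j" using Z W[OF j] by (auto simp: X'_def)
    have card_W: "0 < card (W j)" "(p - d) * card (Y j) \<le> card (W j)"
      using W(2)[OF j] a_ge[OF j] by auto
    have dens: "(p - d + excess (card (T j)) (b j) * (1 - 1 / t)) * card (W j) \<le> card (N j y \<inter> W j)"
      if y: "y \<in> X'" for y
    proof -
      have "e j * (1 - 1 / t) \<le> (q j - p + d) * (1 - 1 / t)"
        using q_ge[OF j] t by (intro mult_right_mono) auto
      then have "p - d + e j * (1 - 1 / t) \<le> q j - \<alpha> j"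
        by (simp add: \<alpha>_def algebra_simps add_divide_distrib diff_divide_distrib)
      then have "(p - d + e j * (1 - 1 / t)) * a j \<le> (q j - \<alpha> j) * a j"
        by (intro mult_right_mono) auto
      also have "\<dots> \<le> card (N j y \<inter> W j)"
        using bspec[OF bspec[OF W_low j], of y] y by (simp add: q_def X'_def)
      finally show ?thesis by (simp add: W(2)[OF j] e_def)
    qed
    note extended = colour_inv_extend[OF ci[OF j] T[OF j] x X(3) sub card_W dens]
    have "colour_inv i X' ((Y(j := W j)) i) (T' i) (b i)" if "i \<in> {1..r}" for i
      using colour_inv_subset[OF ci[OF that]] sub(1) extended(1) by (simp add: T'_def)
    moreover have sum_T': "(\<Sum>i=1..r. real (card (T' i))) = (\<Sum>i=1..r. real (card (T i))) + 1"
    proof -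
      have "(\<lambda>i. real (card (T' i))) = (\<lambda>i. real (card (T i)))(j := real (card (T j)) + 1)"
        using extended(2) by (auto simp: T'_def)
      then show ?thesis
        using upd[OF j, of "\<lambda>i. real (card (T i))" "real (card (T j)) + 1"] by (simp only:)
    qed
    moreover have "ln (card X\<^sub>0) \<le> cX * ((\<Sum>i=1..r. real (card (T i))) + 1)
        + bX * (\<Sum>i=1..r. b i) + ln (card X')"
    proof -
      have "ln (card Z) \<le> ln (2 * real r * card X')"
        using pop Z_pos by (simp add: X'_def)
      also have "\<dots> = ln (2 * real r) + ln (card X')" using r X'_pos by (simp add: ln_mult)
      finally show ?thesis using process_invD(3)[OF inv] Z_ln cost by (simp add: algebra_simps)
    qed
    moreover have "X' \<subseteq> Kn_verts n" "X' \<noteq> {}" using Z_sub X'_pos by (auto simp: X'_def)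
    ultimately have "process_inv X' (Y(j := W j)) T' b"
      unfolding process_inv_def by simp
    moreover have "progress T b + 1 \<le> progress T' b" unfolding progress_def sum_T' by simp
    ultimately show thesis by (rule that)
  qed
qed

text \<open>Without a book no spine reaches \<open>t\<close> vertices, so a step is always possible
  and \<open>progress\<close> exceeds every bound, against \<open>progress_le\<close>.\<close>

lemma contains_book: "contains_mono_book n r \<chi> t m"
proof (rule ccontr)
  assume no: "\<not> ?thesis"
  have "\<exists>X Y T b. process_inv X Y T b \<and> real k \<le> progress T b" for k
  proof (induction k)
    case 0
    have "process_inv X\<^sub>0 Y\<^sub>0 (\<lambda>_. {}) (\<lambda>_. 0) \<and> real 0 \<le> progress (\<lambda>_. {}) (\<lambda>_. 0)"
      using process_inv_initial by (simp add: progress_def)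
    then show ?case by blast
  next
    case (Suc k)
    then obtain X Y T b where inv: "process_inv X Y T b" and k: "real k \<le> progress T b" by blast
    have "card (T i) < t" if "i \<in> {1..r}" for i
      using contains_book_of_inv[OF inv that] no colour_invD(4)[OF process_invD(4)[OF inv that]]
      by (cases "card (T i) = t") auto
    then obtain X' Y' T' b' where "process_inv X' Y' T' b'" "progress T b + 1 \<le> progress T' b'"
      using process_step[OF inv] by blast
    then show ?case using k by (intro exI[of _ X'] exI[of _ Y'] exI[of _ T'] exI[of _ b']) simp
  qed
  moreover obtain k where "real r * real t + real r * ln (4 / d) / ln (1 + L / t) < real k"
    using reals_Archimedean2 by blast
  ultimately show False using progress_le by (meson leD le_less_trans order_trans)
qed

end

section \<open>Choice of parameters\<close>

locale book_parameters =
  fixes r t :: nat and p \<mu> :: real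
  assumes r: "1 \<le> r" and p: "0 < p" "p \<le> 1" and \<mu>: "2 ^ 10 * real r ^ 3 \<le> \<mu>" and t: "\<mu> ^ 5 / p \<le> real t"
begin

text \<open>\<open>L\<close> is chosen so that \<open>C sqrt L = \<mu> D / 8\<close>: the colour steps then cost \<open>X\<close> only a constant
  fraction of its budget, while the boosts of a colour, at most about \<open>2 D t / L\<close> many and each
  shrinking \<open>Y i\<close> by a factor of about \<open>p \<ge> exp (- D)\<close>, cost it \<open>exp (O (r\<^sup>3 t / \<mu>\<^sup>2))\<close> in total.\<close>

definition "D = ln (\<mu>\<^sup>2 / p)"
definition "d = p / \<mu>\<^sup>2"
definition "L = \<mu>\<^sup>2 * D\<^sup>2 / (2 ^ 10 * real r ^ 3)"
definition "cX = ln (2 * real r / corr_const r) + corr_cost r * sqrt (L + 1)"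
definition "bX = 2 * corr_cost r * (t / sqrt L + sqrt (4 * real t / d))"

section \<open>Elementary parameter estimates\<close>

lemma r_powers: "1 \<le> real r" "real r \<le> real r ^ 3" "1 \<le> real r ^ 3"
  using r power_increasing[of 1 3 "real r"] by (auto simp: self_le_power)

lemma \<mu>_ge: "1024 \<le> \<mu>" "1024 * real r \<le> \<mu>" "1024 * real r ^ 3 \<le> \<mu>"
proof -
  show "1024 * real r ^ 3 \<le> \<mu>" using \<mu> by simp
  then show "1024 \<le> \<mu>" "1024 * real r \<le> \<mu>" using r_powers by linarith+
qed

text \<open>Two uses of the lower bound on \<open>t\<close>: \<open>1 \<le> t * d\<close> gives
  \<open>sqrt (t / d) \<le> t\<close> in the boost cost, and the third inequality lets
  \<open>t / \<mu>\<^sup>2\<close> absorb a multiple of \<open>D\<^sup>2\<close>.\<close>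

lemma t_ge: "\<mu> ^ 5 \<le> t" "1 \<le> t * d" "1024 * (\<mu>\<^sup>2 / p) \<le> t / \<mu>\<^sup>2" "2 \<le> t"
proof -
  have \<mu>5: "\<mu> ^ 5 = \<mu> ^ 3 * \<mu>\<^sup>2" by (simp flip: power_add)
  have "\<mu> ^ 5 \<le> \<mu> ^ 5 / p" using p \<mu>_ge by (simp add: le_divide_eq mult_left_le)
  then show *: "\<mu> ^ 5 \<le> t" using t by linarith
  have "\<mu> \<le> \<mu> ^ 5" using \<mu>_ge by (intro self_le_power) auto
  then show "2 \<le> t" using * \<mu>_ge by linarith
  have "\<mu> ^ 3 / p * \<mu>\<^sup>2 \<le> t" using t by (simp only: \<mu>5 times_divide_eq_left)
  then have t': "\<mu> ^ 3 / p \<le> t / \<mu>\<^sup>2" using \<mu>_ge by (subst pos_le_divide_eq) auto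
  have "1024 * \<mu>\<^sup>2 \<le> \<mu> ^ 3" using \<mu>_ge by (simp add: power2_eq_square power3_eq_cube)
  then have "1024 * \<mu>\<^sup>2 / p \<le> \<mu> ^ 3 / p" using p by (intro divide_right_mono) auto
  then show "1024 * (\<mu>\<^sup>2 / p) \<le> t / \<mu>\<^sup>2" using t' by simp
  have "\<mu> ^ 3 / p * p \<le> t / \<mu>\<^sup>2 * p" using t' p by (intro mult_right_mono) auto
  moreover have "1 \<le> \<mu> ^ 3" using \<mu>_ge by simp
  ultimately show "1 \<le> t * d" using p by (simp add: d_def)
qed

lemma ratio_ge: "1024 \<le> \<mu>\<^sup>2 / p" "\<mu>\<^sup>2 \<le> \<mu>\<^sup>2 / p"
proof -
  show *: "\<mu>\<^sup>2 \<le> \<mu>\<^sup>2 / p" using p by (simp add: le_divide_eq mult_left_le)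
  have "\<mu> \<le> \<mu>\<^sup>2" using \<mu>_ge by (intro self_le_power) auto
  then show "1024 \<le> \<mu>\<^sup>2 / p" using * \<mu>_ge by linarith
qed

lemma D_ge: "2 \<le> D"
proof -
  have "exp (2 :: real) = exp 1 * exp 1" by (simp flip: exp_add)
  also have "\<dots> \<le> 3 * 3" using exp_le by (intro mult_mono) auto
  finally have "exp 2 \<le> \<mu>\<^sup>2 / p" using ratio_ge by simp
  then show ?thesis using ratio_ge by (simp add: D_def ln_ge_iff)
qed

lemma D_sq_le: "D\<^sup>2 \<le> 4 * (\<mu>\<^sup>2 / p)"
proof -
  have "D = 2 * ln (sqrt (\<mu>\<^sup>2 / p))" using ratio_ge by (simp add: D_def ln_sqrt)
  also have "\<dots> \<le> 2 * sqrt (\<mu>\<^sup>2 / p)"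
    using ratio_ge ln_le_minus_one[of "sqrt (\<mu>\<^sup>2 / p)"] by fastforce
  finally have "D\<^sup>2 \<le> (2 * sqrt (\<mu>\<^sup>2 / p))\<^sup>2" using D_ge by (intro power_mono) auto
  then show ?thesis using ratio_ge by (simp add: power_mult_distrib)
qed

text \<open>As \<open>d\<close> is at most half of \<open>p\<close>, also
  \<open>d \<le> p - d\<close>, so \<open>1 / (p - d) \<le> 1 / d\<close>.\<close>

lemma d_bounds: "0 < d" "d < p" "1 / (p - d) \<le> \<mu>\<^sup>2 / p"
proof -
  have "2 \<le> \<mu>\<^sup>2" using \<mu>_ge self_le_power[of \<mu> 2] by simp
  moreover have "\<mu>\<^sup>2 * d = p" "0 < d" using p \<mu>_ge by (auto simp: d_def)
  ultimately have "2 * d \<le> p" "0 < d" using mult_right_mono[of 2 "\<mu>\<^sup>2" d] by auto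
  then show "0 < d" "d < p" "1 / (p - d) \<le> \<mu>\<^sup>2 / p"
    using frac_le[of 1 1 d "p - d"] by (auto simp: d_def)
qed

lemma ln_4_div_d: "ln (4 / d) \<le> 2 * D"
proof -
  have "ln (4 :: real) \<le> 2"
    using ln_le_minus_one[of "2 :: real"] ln_realpow[of "2 :: real" 2] by simp
  moreover have "4 / d = 4 * (\<mu>\<^sup>2 / p)" by (simp add: d_def)
  then have "ln (4 / d) = ln 4 + D"
    using ratio_ge unfolding D_def by (simp only:) (intro ln_mult_pos, auto)
  ultimately show ?thesis using D_ge by linarith
qed

lemma corr_bounds:
  "ln (1 / corr_const r) \<le> 8 * real r" "4 * real r \<le> corr_cost r" "corr_cost r \<le> 4 * real r ^ 3"
  "corr_cost r \<le> \<mu> / 256" "0 < corr_cost r"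
proof -
  have "ln (1 / corr_const r) = 4 * real r * ln 3"
    by (simp add: corr_const_def ln_realpow ln_div power_one_over)
  also have "\<dots> \<le> 4 * real r * 2"
    using ln_le_minus_one[of "3 :: real"] by (intro mult_left_mono) auto
  finally show "ln (1 / corr_const r) \<le> 8 * real r" by simp
  have "real r \<le> real r ^ 2" using r_powers by (intro self_le_power) auto
  moreover from this have "sqrt r \<le> real r" by (intro real_le_lsqrt) auto
  ultimately have s: "1 \<le> sqrt r" "sqrt r \<le> real r ^ 2"
    using r_powers by (simp, linarith)
  have "real r * 1 \<le> real r * sqrt r" using s by (intro mult_left_mono) auto
  then show *: "4 * real r \<le> corr_cost r" by (simp add: corr_cost_def)
  then show "0 < corr_cost r" using r_powers by linarith
  have "real r * sqrt r \<le> real r * real r ^ 2" using s by (intro mult_left_mono) auto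
  then show "corr_cost r \<le> 4 * real r ^ 3"
    by (simp add: corr_cost_def power2_eq_square power3_eq_cube)
  then show "corr_cost r \<le> \<mu> / 256" using \<mu>_ge by linarith
qed

lemma corr_cost_sqrt_L: "corr_cost r * sqrt L = \<mu> * D / 8"
proof -
  have "sqrt L = \<mu> * D / sqrt (2 ^ 10 * real r ^ 3)"
    using \<mu>_ge D_ge by (simp add: L_def real_sqrt_divide real_sqrt_mult)
  also have "2 ^ 10 * real r ^ 3 = (32 * (real r * sqrt r))\<^sup>2"
    by (simp add: power_mult_distrib power2_eq_square power3_eq_cube)
  also have "sqrt \<dots> = 32 * (real r * sqrt r)" by (intro real_sqrt_unique) auto
  finally show ?thesis using r_powers by (simp add: corr_cost_def)
qed

lemma L_ge: "16 \<le> L"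
proof -
  have "\<mu> * 1024 * real r ^ 3 \<le> \<mu> * \<mu>"
    using mult_left_mono[OF \<mu>_ge(3), of \<mu>] \<mu>_ge(1) by (simp add: mult.assoc)
  then have "\<mu> \<le> \<mu>\<^sup>2 / (2 ^ 10 * real r ^ 3)"
    using r_powers by (simp add: le_divide_eq power2_eq_square mult_ac)
  then have "1024 * 1 \<le> \<mu>\<^sup>2 / (2 ^ 10 * real r ^ 3) * D\<^sup>2"
    using \<mu>_ge D_ge by (intro mult_mono) (auto simp: one_le_power)
  then show ?thesis by (simp add: L_def)
qed

section \<open>The logarithmic budgets of the vertex sets\<close>

lemma sqrt_one_plus_le: "0 \<le> x \<Longrightarrow> sqrt (x + 1) \<le> sqrt x + 1"
  using sqrt_add_le_add_sqrt[of x 1] by simp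

lemma cX_le: "cX \<le> 3 / 8 * (\<mu> * D)"
proof -
  have "ln (2 * real r / corr_const r) = ln (2 * real r) + ln (1 / corr_const r)"
    using r_powers by (simp add: ln_div ln_mult corr_const_def)
  also have "\<dots> \<le> 2 * real r + 8 * real r"
    using r_powers corr_bounds ln_le_minus_one[of "2 * real r"] by (intro add_mono) auto
  also have "\<dots> \<le> \<mu> / 8 * 1" using \<mu>_ge by simp
  also have "\<dots> \<le> \<mu> / 8 * D" using \<mu>_ge D_ge by (intro mult_left_mono) auto
  finally have "ln (2 * real r / corr_const r) \<le> \<mu> / 8 * D" .
  moreover have "1 \<le> sqrt L" using L_ge by simp
  then have "sqrt (L + 1) \<le> 2 * sqrt L" using sqrt_one_plus_le[of L] L_ge by linarith
  then have "corr_cost r * sqrt (L + 1) \<le> corr_cost r * (2 * sqrt L)"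
    using corr_bounds by (intro mult_left_mono) auto
  ultimately show ?thesis using corr_cost_sqrt_L by (simp add: cX_def)
qed

text \<open>The cost is at most \<open>2 * corr_cost r * sqrt s\<close>, and \<open>sqrt s\<close>
  is \<open>s / (t + s)\<close>, a lower bound for \<open>ln (1 + s / t)\<close>, times
  \<open>t / sqrt s + sqrt s\<close>. Bounding the two summands at opposite ends of the range of
  \<open>s\<close> gives \<open>bX\<close>.\<close>

lemma boost_cost:
  assumes s: "L \<le> s" "s \<le> 4 * real t / d"
  shows "ln (1 / corr_const r) + corr_cost r * sqrt (s + 1) \<le> bX * ln (1 + s / t)"
proof -
  have t0: "0 < real t" using t_ge by simp
  have s16: "16 \<le> s" using s L_ge by simp
  have "4 \<le> sqrt s" using s16 real_sqrt_le_mono[of 16 s] by simp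
  then have "2 + sqrt (s + 1) \<le> 2 * sqrt s" using sqrt_one_plus_le[of s] s16 by simp
  then have "corr_cost r * (2 + sqrt (s + 1)) \<le> corr_cost r * (2 * sqrt s)"
    using corr_bounds by (intro mult_left_mono) auto
  then have "ln (1 / corr_const r) + corr_cost r * sqrt (s + 1) \<le> 2 * corr_cost r * sqrt s"
    using corr_bounds by (simp add: algebra_simps)
  also have "sqrt s = (t / sqrt s + sqrt s) * (s / (t + s))"
  proof -
    have "t / sqrt s + sqrt s = (t + s) / sqrt s" using s16 by (simp add: field_simps)
    then have "(t / sqrt s + sqrt s) * (s / (t + s)) = s / sqrt s" using s16 t0 by simp
    then show ?thesis using s16 by (simp add: real_div_sqrt)
  qed
  also have "\<dots> \<le> (t / sqrt L + sqrt (4 * real t / d)) * ln (1 + s / t)"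
    using s s16 t0 L_ge
    by (intro mult_mono add_mono divide_le_ln_one_plus divide_left_mono) auto
  finally show ?thesis using corr_bounds by (simp add: bX_def mult.assoc mult_left_mono)
qed

lemma bX_le: "bX * D \<le> \<mu> * t * D / 8" "0 \<le> bX"
proof -
  have t0: "0 < real t" using t_ge by simp
  have sL: "0 < sqrt L" using L_ge by simp
  have "corr_cost r / sqrt L = corr_cost r ^ 2 / (corr_cost r * sqrt L)"
    using corr_bounds by (simp add: power2_eq_square)
  also have "corr_cost r ^ 2 = 16 * real r ^ 3"
    by (simp add: corr_cost_def power_mult_distrib power2_eq_square power3_eq_cube)
  also have "\<dots> / (corr_cost r * sqrt L) \<le> (\<mu> / 64) / (corr_cost r * sqrt L)"
    using \<mu>_ge sL corr_bounds by (intro divide_right_mono) auto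
  also have "\<dots> = 1 / (8 * D)" using \<mu>_ge D_ge by (simp add: corr_cost_sqrt_L field_simps)
  finally have "corr_cost r / sqrt L * D \<le> 1 / (8 * D) * D"
    using D_ge by (intro mult_right_mono) auto
  then have A: "corr_cost r / sqrt L * D \<le> 1 / 8" using D_ge by simp
  have "real t / d \<le> (real t)\<^sup>2"
    using t_ge(2) d_bounds t0 by (simp add: divide_le_eq power2_eq_square)
  then have "sqrt (real t / d) \<le> t" using t0 by (intro real_le_lsqrt) auto
  then have "sqrt (4 * real t / d) \<le> 2 * t" by (simp add: real_sqrt_mult flip: times_divide_eq_right)
  then have "corr_cost r * sqrt (4 * real t / d) \<le> \<mu> / 256 * (2 * t)"
    using corr_bounds t0 d_bounds \<mu>_ge by (intro mult_mono) auto
  then have B: "corr_cost r * sqrt (4 * real t / d) * D \<le> \<mu> / 256 * (2 * t) * D"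
    using D_ge by (intro mult_right_mono) auto
  have "bX * D = 2 * t * (corr_cost r / sqrt L * D) + 2 * (corr_cost r * sqrt (4 * real t / d) * D)"
    by (simp add: bX_def algebra_simps)
  also have "\<dots> \<le> 2 * t * (1 / 8) + 2 * (\<mu> / 256 * (2 * t) * D)"
    using A B t0 by (intro add_mono mult_left_mono) auto
  also have "2 * t * (1 / 8) \<le> \<mu> * t * D / 16"
  proof -
    have "4 * 1 \<le> \<mu> * D" using \<mu>_ge D_ge by (intro mult_mono) auto
    then show ?thesis using t0 mult_right_mono[of 4 "\<mu> * D" t] by (simp add: mult_ac)
  qed
  also have "2 * (\<mu> / 256 * (2 * t) * D) \<le> \<mu> * t * D / 16"
    using t0 \<mu>_ge D_ge by simp
  finally show "bX * D \<le> \<mu> * t * D / 8" by simp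
  show "0 \<le> bX" using corr_bounds sL t0 d_bounds by (simp add: bX_def)
qed

text \<open>Spine steps use at most three quarters of the budget, boosts at most one
  quarter.\<close>

lemma size_X: "cX * (real r * real t + 1) + bX * (real r * ln (4 / d)) \<le> \<mu> * real r * real t * D"
proof -
  have rt: "1 \<le> real r * real t" using r_powers t_ge mult_mono[of 1 "real r" 1 "real t"] by simp
  have "cX * (real r * real t + 1) \<le> 3 / 8 * (\<mu> * D) * (2 * (real r * real t))"
    using cX_le rt \<mu>_ge D_ge by (intro mult_mono) auto
  moreover have "bX * (real r * ln (4 / d)) \<le> bX * (real r * (2 * D))"
    using bX_le(2) ln_4_div_d by (intro mult_left_mono) auto
  moreover have "real r * 2 * (bX * D) \<le> real r * 2 * (\<mu> * t * D / 8)"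
    using bX_le(1) by (intro mult_left_mono) auto
  moreover have "3 / 8 * (\<mu> * D) * (2 * (real r * real t)) = 3 / 4 * (\<mu> * real r * real t * D)"
    "bX * (real r * (2 * D)) = real r * 2 * (bX * D)"
    "real r * 2 * (\<mu> * t * D / 8) = 1 / 4 * (\<mu> * real r * real t * D)"
    by simp_all
  ultimately show ?thesis by linarith
qed

text \<open>In units of \<open>u = t / \<mu>\<^sup>2\<close>, replacing \<open>p\<close> by
  \<open>p - d\<close> costs 2 over \<open>t\<close> spine steps, and the boost term splits into 1
  and \<open>2 ^ 11 * r ^ 3\<close>; the latter is \<open>2 * D\<^sup>2 * (t / L)\<close>.\<close>

lemma size_Y:
  "ln (1 / (p - d)) * (real t + ln (4 / d) * (1 + t / L)) \<le> t * (2 ^ 13 * real r ^ 3 / \<mu>\<^sup>2 + ln (1 / p))"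
proof -
  define q where "q = ln (1 / (p - d))"
  define u where "u = t / \<mu>\<^sup>2"
  have t0: "0 < real t" using t_ge by simp
  have \<mu>2: "1024 \<le> \<mu>\<^sup>2" using \<mu>_ge self_le_power[of \<mu> 2] by simp
  have q0: "0 \<le> q" using d_bounds p by (simp add: q_def)
  have qD: "q \<le> D" using d_bounds ratio_ge by (simp add: q_def D_def)
  have "q \<le> ln (1 / p) + 2 / \<mu>\<^sup>2"
  proof -
    define x where "x = 1 / \<mu>\<^sup>2"
    have x: "0 \<le> x" "x \<le> 1 / 2" using \<mu>2 by (auto simp: x_def divide_le_eq)
    have "1 / (p - d) = 1 / p * (1 / (1 - x))"
      by (simp add: d_def x_def right_diff_distrib)
    then have "q = ln (1 / p) + ln (1 / (1 - x))"
      using p x unfolding q_def by (simp only:) (intro ln_mult_pos, auto)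
    also have "ln (1 / (1 - x)) \<le> 1 / (1 - x) - 1"
      using x by (intro ln_le_minus_one) auto
    also have "\<dots> \<le> 2 / \<mu>\<^sup>2"
    proof -
      have "0 \<le> x * (1 - 2 * x)" using x by (intro mult_nonneg_nonneg) auto
      then have "1 \<le> (1 + 2 * x) * (1 - x)" by (simp add: algebra_simps)
      then have "1 / (1 - x) \<le> 1 + 2 * x" using x by (simp add: pos_divide_le_eq)
      then show ?thesis by (simp add: x_def)
    qed
    finally show ?thesis by simp
  qed
  then have "q * t \<le> (ln (1 / p) + 2 / \<mu>\<^sup>2) * t" using t0 by (intro mult_right_mono) auto
  then have 1: "q * t \<le> t * ln (1 / p) + 2 * u" by (simp add: u_def algebra_simps)
  have "q * ln (4 / d) \<le> D * (2 * D)"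
    using qD ln_4_div_d q0 D_ge d_bounds p by (intro mult_mono) auto
  then have qd: "q * ln (4 / d) \<le> 2 * D\<^sup>2" by (simp add: power2_eq_square)
  have 2: "q * ln (4 / d) \<le> u" using qd D_sq_le t_ge(3) ratio_ge unfolding u_def by linarith
  have "q * ln (4 / d) * (t / L) \<le> 2 * D\<^sup>2 * (t / L)"
    using qd t0 L_ge by (intro mult_right_mono) auto
  also have "\<dots> = 2 ^ 11 * real r ^ 3 * u"
    using D_ge by (simp add: L_def u_def)
  finally have 3: "q * ln (4 / d) * (t / L) \<le> 2 ^ 11 * real r ^ 3 * u" .
  have "3 * u \<le> 3 * real r ^ 3 * u"
    using r_powers t0 mult_right_mono[of 1 "real r ^ 3" u] by (simp add: u_def)
  moreover have "0 \<le> real r ^ 3 * u" using t0 by (simp add: u_def)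
  ultimately have "q * (real t + ln (4 / d) * (1 + t / L)) \<le> t * ln (1 / p) + 2 ^ 13 * real r ^ 3 * u"
    using 1 2 3 by (simp add: algebra_simps)
  then show ?thesis by (simp add: q_def u_def algebra_simps)
qed

end

theorem theorem2p1:
  fixes n r t m :: nat
    and \<chi> :: "nat set \<Rightarrow> nat"
    and X :: "nat set"
    and Y :: "nat \<Rightarrow> nat set"
    and p \<mu> :: real
  assumes "r \<ge> 1" and "m \<ge> 1"
    and "edge_colouring n r \<chi>"
    and "X \<subseteq> Kn_verts n"
    and "\<And>i. i \<in> {1..r} \<Longrightarrow> Y i \<subseteq> Kn_verts n"
    and "p > 0"
    and "\<mu> \<ge> 2 ^ 10 * real r ^ 3"
    and "real t \<ge> \<mu> ^ 5 / p"
    and "\<And>x i. x \<in> X \<Longrightarrow> i \<in> {1..r} \<Longrightarrow>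
           real (card (col_nbhd n \<chi> i x \<inter> Y i)) \<ge> p * real (card (Y i))"
    and "real (card X) \<ge> (\<mu> ^ 2 / p) powr (\<mu> * real r * real t)"
    and "\<And>i. i \<in> {1..r} \<Longrightarrow>
           real (card (Y i)) \<ge> (exp (2 ^ 13 * real r ^ 3 / \<mu> ^ 2) / p) ^ t * real m"
  shows "contains_mono_book n r \<chi> t m"
proof -
  have "1 \<le> real r ^ 3" using assms(1) by simp
  moreover have "1024 * real r ^ 3 \<le> \<mu>" using assms(7) by simp
  ultimately have \<mu>0: "0 < \<mu>" by linarith
  have Xpos: "0 < card X"
  proof -
    have "0 < (\<mu> ^ 2 / p) powr (\<mu> * real r * real t)" using \<mu>0 assms(6) by simp
    then have "0 < real (card X)" using assms(10) by linarith
    then show ?thesis by simp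
  qed
  have base: "0 < (exp (2 ^ 13 * real r ^ 3 / \<mu> ^ 2) / p) ^ t * real m"
    using assms(2,6) by simp
  have Ypos: "0 < card (Y i)" if "i \<in> {1..r}" for i
  proof -
    have "0 < real (card (Y i))" using base assms(11)[OF that] by linarith
    then show ?thesis by simp
  qed
  \<comment> \<open>Forced by the degree condition at any vertex of the nonempty
    \<open>X\<close>.\<close>
  have "p \<le> 1"
  proof -
    obtain x where x: "x \<in> X" using Xpos by fastforce
    have one: "1 \<in> {1..r}" using assms(1) by simp
    have "p * card (Y 1) \<le> card (col_nbhd n \<chi> 1 x \<inter> Y 1)" by (rule assms(9)[OF x one])
    also have "\<dots> \<le> 1 * card (Y 1)" using Ypos[OF one] by (simp add: card_mono card_gt_0_iff)
    finally show ?thesis using Ypos[OF one] by simp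
  qed
  then interpret par: book_parameters r t p \<mu>
    using assms by unfold_locales auto
  interpret book_process n r t m \<chi> X Y p par.d par.L par.cX par.bX
  proof unfold_locales
    show "X \<noteq> {}" "\<And>i. i \<in> {1..r} \<Longrightarrow> Y i \<noteq> {}" using Xpos Ypos by force+
    show "1 \<le> par.L" using par.L_ge by simp
    show "ln (2 * real r / corr_const r) + corr_cost r * sqrt (par.L + 1) \<le> par.cX"
      by (simp add: par.cX_def)
    have "ln ((\<mu> ^ 2 / p) powr (\<mu> * real r * real t)) \<le> ln (card X)"
      using assms(6,10) \<mu>0 by (intro ln_mono) auto
    then have "\<mu> * real r * real t * par.D \<le> ln (card X)"
      using assms(6) \<mu>0 by (simp add: par.D_def ln_powr)
    then show "par.cX * (real r * real t + 1) + par.bX * (real r * ln (4 / par.d)) \<le> ln (card X)"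
      using par.size_X by linarith
  next
    fix i assume i: "i \<in> {1..r}"
    have "ln ((exp (2 ^ 13 * real r ^ 3 / \<mu> ^ 2) / p) ^ t * real m) \<le> ln (card (Y i))"
      using assms(11)[OF i] base by simp
    also have "ln ((exp (2 ^ 13 * real r ^ 3 / \<mu> ^ 2) / p) ^ t * real m)
        = t * (2 ^ 13 * real r ^ 3 / \<mu> ^ 2 + ln (1 / p)) + ln m"
      using assms(2,6) by (simp add: ln_mult ln_realpow ln_div)
    finally show "ln m + ln (1 / (p - par.d)) * (real t + ln (4 / par.d) * (1 + t / par.L))
        \<le> ln (card (Y i))"
      using par.size_Y by linarith
  next
    show "ln (1 / corr_const r) + corr_cost r * sqrt (s + 1) \<le> par.bX * ln (1 + s / t)"
      if "par.L \<le> s" "s \<le> 4 * real t / par.d" for s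
      using that by (rule par.boost_cost)
    show "p * real (card (Y i)) \<le> real (card (col_nbhd n \<chi> i x \<inter> Y i))"
      if "x \<in> X" "i \<in> {1..r}" for x i
      using that by (rule assms(9))
    show "Y i \<subseteq> Kn_verts n" if "i \<in> {1..r}" for i using that by (rule assms(5))
  qed (fact assms(1,2,3,4) \<open>p \<le> 1\<close> par.t_ge(4) par.d_bounds(1,2) par.bX_le(2))+
  show ?thesis by (rule contains_book)
qed

end
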